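(* Let $\mu=e^{-2F}dx$ be a probability measure on $\mathbb R^d$, with $F$ locally bounded, invariant for a Markov generator $L$ with carré du champ $\Gamma(f)=|\nabla f|^2$, and assume that $\mu$ satisfies a Poincaré inequality on the whole of $\mathbb R^d$ with constant $C_P$, i.e. $\mathrm{Var}_\mu(f)\le C_P\int|\nabla f|^2\,d\mu$ for all nice $f$. Assume that there exists a Lyapunov function $V$, i.e. $V\in D(L)$, $V\ge1$ and $LV\le-2\alpha V+b\,\mathbf 1_C$ for some constants $\alpha>0$, $b$ and some set $C$ (not necessarily petite), such that either $C$ is compact or the level sets $\{V\le r\}$ of $V$ are compact. Let $\Psi:\mathbb R^+\to\mathbb R$ be defined by $$\Psi(u)=(u-1)^2\,\mathbf 1_{u\le2}+\Big(1+(2-4\log2)(u-2)+4\,(u\log u-u-2\log2+2)\Big)\mathbf 1_{u>2}.$$ Then, for every large enough constant $\lambda$, with $W=V+\lambda$, $\mu$ satisfies a $(W)$-Lyapunov-$\Psi$-Sobolev inequality: there is a constant $C_\Psi$ such that for all nice non-negative $h$ with $\int h\,d\mu=1$, $$\int\Psi(h)\,W\,d\mu\le C_\Psi\int\left(\tfrac12\,W\,\Psi''(h)\,\Gamma(h)-\Psi(h)\,LW\right)d\mu.$$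
   Context: $D(L)$ is the extended domain of $L$. Standing assumption: there is an algebra of functions which is a core for $L$ ("nice" functions are functions in this algebra, regular enough for the expressions to make sense) and on which $L(fg)=fLg+gLf+\Gamma(f,g)$ and $\Gamma(fg,h)=f\Gamma(g,h)+g\Gamma(f,h)$; $\Gamma(f)=\Gamma(f,f)$. The function $\Psi$ satisfies $\Psi''(u)=2\,\mathbf 1_{u\le2}+\frac4u\,\mathbf 1_{u>2}$. *)

theory Defs
  imports "HOL-Probability.Probability"
begin

section \<open>Markov processes and their semigroup\<close>

definition transition ::
  "('a::euclidean_space \<Rightarrow> 'w measure) \<Rightarrow> (real \<Rightarrow> 'w \<Rightarrow> 'a) \<Rightarrow> real \<Rightarrow> 'a \<Rightarrow> 'a measure" where
  "transition Pr X t x = distr (Pr x) borel (X t)"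

definition semigroup_op ::
  "('a::euclidean_space \<Rightarrow> 'w measure) \<Rightarrow> (real \<Rightarrow> 'w \<Rightarrow> 'a) \<Rightarrow> real \<Rightarrow> ('a \<Rightarrow> real) \<Rightarrow> 'a \<Rightarrow> real" where
  "semigroup_op Pr X t f x = (\<integral>y. f y \<partial>(transition Pr X t x))"

text \<open>
  A right-continuous, conservative, time-homogeneous Markov process \<open>(X\<^sub>t, P\<^sub>x)\<close>. The measurable
  space \<open>Om\<close> carries all the laws \<open>Pr x\<close>. Time is \<open>real\<close>, but only \<open>t \<ge> 0\<close> matters: the sigma
  algebras \<open>Fil t\<close> with \<open>t < 0\<close> are irrelevant (one may take \<open>Fil t = Fil 0\<close>). The
  filtration need not be completed; augmented filtrations are covered as well.
\<close>

definition markov_process ::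
  "'w measure \<Rightarrow> ('a::euclidean_space \<Rightarrow> 'w measure) \<Rightarrow> (real \<Rightarrow> 'w measure) \<Rightarrow>
   (real \<Rightarrow> 'w \<Rightarrow> 'a) \<Rightarrow> bool" where
  "markov_process Om Pr Fil X \<longleftrightarrow>
     (\<forall>x. prob_space (Pr x) \<and> sets (Pr x) = sets Om) \<and>
     filtration (space Om) Fil \<and> (\<forall>t. sets (Fil t) \<subseteq> sets Om) \<and>
     (\<forall>t\<ge>0. X t \<in> borel_measurable (Fil t)) \<and>
     (\<forall>\<omega>\<in>space Om. \<forall>t\<ge>0. ((\<lambda>s. X s \<omega>) \<longlongrightarrow> X t \<omega>) (at_right t)) \<and>
     (\<forall>x. AE \<omega> in Pr x. X 0 \<omega> = x) \<and>
     (\<forall>t\<ge>0. transition Pr X t \<in> measurable borel (prob_algebra borel)) \<and>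
     (\<forall>x. \<forall>s\<ge>0. \<forall>t\<ge>0. \<forall>B\<in>sets borel. AE \<omega> in Pr x.
        real_cond_exp (Pr x) (Fil s) (\<lambda>\<omega>'. indicat_real B (X (s + t) \<omega>')) \<omega>
          = measure (transition Pr X t (X s \<omega>)) B)"

definition invariant_measure ::
  "('a::euclidean_space \<Rightarrow> 'w measure) \<Rightarrow> (real \<Rightarrow> 'w \<Rightarrow> 'a) \<Rightarrow> 'a measure \<Rightarrow> bool" where
  "invariant_measure Pr X \<mu> \<longleftrightarrow> (\<forall>t\<ge>0. \<mu> \<bind> transition Pr X t = \<mu>)"


section \<open>The extended domain of the generator\<close>

definition martingale :: "'w measure \<Rightarrow> (real \<Rightarrow> 'w measure) \<Rightarrow> (real \<Rightarrow> 'w \<Rightarrow> real) \<Rightarrow> bool" where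
  "martingale M Fil Y \<longleftrightarrow>
     (\<forall>t\<ge>0. Y t \<in> borel_measurable (Fil t) \<and> integrable M (Y t)) \<and>
     (\<forall>s\<ge>0. \<forall>t\<ge>s. AE \<omega> in M. real_cond_exp M (Fil s) (Y t) \<omega> = Y s \<omega>)"

text \<open>
  Real-valued localizing times are no restriction, since \<open>\<tau> n\<close> can be replaced by \<open>min n (\<tau> n)\<close>.
\<close>

definition local_martingale ::
  "'w measure \<Rightarrow> (real \<Rightarrow> 'w measure) \<Rightarrow> (real \<Rightarrow> 'w \<Rightarrow> real) \<Rightarrow> bool" where
  "local_martingale M Fil Y \<longleftrightarrow>
     (\<forall>t\<ge>0. Y t \<in> borel_measurable (Fil t)) \<and>
     (AE \<omega> in M. \<forall>t\<ge>0. ((\<lambda>s. Y s \<omega>) \<longlongrightarrow> Y t \<omega>) (at_right t)) \<and>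
     (\<exists>\<tau> :: nat \<Rightarrow> 'w \<Rightarrow> real.
        (\<forall>n. stopping_time Fil (\<tau> n) \<and> (\<forall>\<omega>. 0 \<le> \<tau> n \<omega>)) \<and>
        (AE \<omega> in M. incseq (\<lambda>n. \<tau> n \<omega>) \<and> filterlim (\<lambda>n. \<tau> n \<omega>) at_top sequentially) \<and>
        (\<forall>n. martingale M Fil (\<lambda>t \<omega>. Y (min t (\<tau> n \<omega>)) \<omega> - Y 0 \<omega>)))"

text \<open>
  \<open>extended_generator Pr Fil X f g\<close>: \<open>f\<close> is in the extended domain and \<open>g\<close> is a version of \<open>L f\<close>, i.e.
  \<open>f(X\<^sub>t) - f(X\<^sub>0) - \<integral>\<^sub>0\<^sup>t g(X\<^sub>s) ds\<close> is a \<open>P\<^sub>x\<close>-local martingale for every \<open>x\<close>.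
\<close>

definition extended_generator ::
  "('a::euclidean_space \<Rightarrow> 'w measure) \<Rightarrow> (real \<Rightarrow> 'w measure) \<Rightarrow> (real \<Rightarrow> 'w \<Rightarrow> 'a) \<Rightarrow>
   ('a \<Rightarrow> real) \<Rightarrow> ('a \<Rightarrow> real) \<Rightarrow> bool" where
  "extended_generator Pr Fil X f g \<longleftrightarrow>
     f \<in> borel_measurable borel \<and> g \<in> borel_measurable borel \<and>
     (\<forall>x. (AE \<omega> in Pr x. \<forall>t\<ge>0. set_integrable lborel {0..t} (\<lambda>s. g (X s \<omega>))) \<and>
          local_martingale (Pr x) Fil
            (\<lambda>t \<omega>. f (X t \<omega>) - f (X 0 \<omega>) - (LINT s:{0..t}|lborel. g (X s \<omega>))))"

definition extended_domain ::
  "('a::euclidean_space \<Rightarrow> 'w measure) \<Rightarrow> (real \<Rightarrow> 'w measure) \<Rightarrow> (real \<Rightarrow> 'w \<Rightarrow> 'a) \<Rightarrow>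
   ('a \<Rightarrow> real) set" where
  "extended_domain Pr Fil X = {f. \<exists>g. extended_generator Pr Fil X f g}"

text \<open>
  \<open>L\<close> selects for every \<open>f\<close> in the extended domain a version of the extended generator. Versions agree
  \<open>\<mu>\<close>-almost everywhere when \<open>\<mu>\<close> is invariant, so all identities involving \<open>L\<close> are stated
  \<open>\<mu>\<close>-almost everywhere. Off the extended domain \<open>L\<close> is unspecified.
\<close>

definition markov_generator ::
  "('a::euclidean_space \<Rightarrow> 'w measure) \<Rightarrow> (real \<Rightarrow> 'w measure) \<Rightarrow> (real \<Rightarrow> 'w \<Rightarrow> 'a) \<Rightarrow>
   'a measure \<Rightarrow> (('a \<Rightarrow> real) \<Rightarrow> ('a \<Rightarrow> real)) \<Rightarrow> bool" where
  "markov_generator Pr Fil X \<mu> L \<longleftrightarrow>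
     (\<forall>f\<in>extended_domain Pr Fil X. extended_generator Pr Fil X f (L f)) \<and>
     (\<forall>f\<in>extended_domain Pr Fil X. \<forall>g\<in>extended_domain Pr Fil X. \<forall>a b :: real.
        AE x in \<mu>. L (\<lambda>y. a * f y + b * g y) x = a * L f x + b * L g x) \<and>
     (AE x in \<mu>. L (\<lambda>_. 1) x = 0)"


section \<open>Core and the carre du champ\<close>

definition square_integrable :: "'a measure \<Rightarrow> ('a \<Rightarrow> real) \<Rightarrow> bool" where
  "square_integrable \<mu> f \<longleftrightarrow> f \<in> borel_measurable \<mu> \<and> integrable \<mu> (\<lambda>x. (f x)\<^sup>2)"

text \<open>\<open>f\<close> is in the domain of the generator of the semigroup on \<open>L\<^sup>2(\<mu>)\<close>, with image \<open>g\<close>.\<close>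

definition L2_generator ::
  "('a::euclidean_space \<Rightarrow> 'w measure) \<Rightarrow> (real \<Rightarrow> 'w \<Rightarrow> 'a) \<Rightarrow> 'a measure \<Rightarrow>
   ('a \<Rightarrow> real) \<Rightarrow> ('a \<Rightarrow> real) \<Rightarrow> bool" where
  "L2_generator Pr X \<mu> f g \<longleftrightarrow>
     square_integrable \<mu> f \<and> square_integrable \<mu> g \<and>
     ((\<lambda>t. \<integral>x. ((semigroup_op Pr X t f x - f x) / t - g x)\<^sup>2 \<partial>\<mu>) \<longlongrightarrow> 0) (at_right 0)"

definition function_algebra :: "('a \<Rightarrow> real) set \<Rightarrow> bool" where
  "function_algebra A \<longleftrightarrow>
     (\<lambda>_. 0) \<in> A \<and>
     (\<forall>f\<in>A. \<forall>g\<in>A. (\<lambda>x. f x + g x) \<in> A \<and> (\<lambda>x. f x * g x) \<in> A) \<and>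
     (\<forall>c :: real. \<forall>f\<in>A. (\<lambda>x. c * f x) \<in> A)"

text \<open>The last clause says that \<open>A\<close> is dense in the \<open>L\<^sup>2(\<mu>)\<close>-domain for the graph norm.\<close>

definition generator_core ::
  "('a::euclidean_space \<Rightarrow> 'w measure) \<Rightarrow> (real \<Rightarrow> 'w measure) \<Rightarrow> (real \<Rightarrow> 'w \<Rightarrow> 'a) \<Rightarrow>
   'a measure \<Rightarrow> (('a \<Rightarrow> real) \<Rightarrow> ('a \<Rightarrow> real)) \<Rightarrow> ('a \<Rightarrow> real) set \<Rightarrow> bool" where
  "generator_core Pr Fil X \<mu> L A \<longleftrightarrow>
     A \<subseteq> extended_domain Pr Fil X \<and>
     (\<forall>f\<in>A. L2_generator Pr X \<mu> f (L f)) \<and>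
     (\<forall>f g. L2_generator Pr X \<mu> f g \<longrightarrow>
        (\<exists>fn :: nat \<Rightarrow> 'a \<Rightarrow> real. (\<forall>n. fn n \<in> A) \<and>
           (\<lambda>n. \<integral>x. (fn n x - f x)\<^sup>2 \<partial>\<mu>) \<longlonglongrightarrow> 0 \<and>
           (\<lambda>n. \<integral>x. (L (fn n) x - g x)\<^sup>2 \<partial>\<mu>) \<longlonglongrightarrow> 0))"

text \<open>Defined so that \<open>L (f g) = f L g + g L f + \<Gamma>(f, g)\<close>; there is no factor \<open>1/2\<close>.\<close>

definition carre_du_champ ::
  "(('a \<Rightarrow> real) \<Rightarrow> ('a \<Rightarrow> real)) \<Rightarrow> ('a \<Rightarrow> real) \<Rightarrow> ('a \<Rightarrow> real) \<Rightarrow> 'a \<Rightarrow> real" where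
  "carre_du_champ L f g x = L (\<lambda>y. f y * g y) x - f x * L g x - g x * L f x"

definition diffusion_on ::
  "'a measure \<Rightarrow> (('a \<Rightarrow> real) \<Rightarrow> ('a \<Rightarrow> real)) \<Rightarrow> ('a \<Rightarrow> real) set \<Rightarrow> bool" where
  "diffusion_on \<mu> L A \<longleftrightarrow>
     (\<forall>f\<in>A. \<forall>g\<in>A. \<forall>h\<in>A. AE x in \<mu>.
        carre_du_champ L (\<lambda>y. f y * g y) h x
          = f x * carre_du_champ L g h x + g x * carre_du_champ L f h x)"

definition C1_function :: "('a::euclidean_space \<Rightarrow> real) \<Rightarrow> bool" where
  "C1_function f \<longleftrightarrow> (\<exists>G. continuous_on UNIV G \<and> (\<forall>x. GDERIV f x :> G x))"

definition gradient :: "('a::euclidean_space \<Rightarrow> real) \<Rightarrow> 'a \<Rightarrow> 'a" where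
  "gradient f x = (THE D. GDERIV f x :> D)"

lemma gradient_eq: "GDERIV f x :> D \<Longrightarrow> gradient f x = D"
  unfolding gradient_def
proof (rule the_equality)
  fix D' assume "GDERIV f x :> D" and "GDERIV f x :> D'"
  then have "(\<lambda>h. inner h D') = (\<lambda>h. inner h D)"
    unfolding gderiv_def by (metis has_derivative_unique)
  then show "D' = D"
    by (metis inner_commute vector_eq_ldot)
qed


section \<open>Functional inequalities\<close>

definition poincare_inequality :: "'a::euclidean_space measure \<Rightarrow> ('a \<Rightarrow> real) set \<Rightarrow> real \<Rightarrow> bool" where
  "poincare_inequality \<mu> A CP \<longleftrightarrow>
     (\<forall>f\<in>A. (\<integral>x. (f x - (\<integral>y. f y \<partial>\<mu>))\<^sup>2 \<partial>\<mu>) \<le> CP * (\<integral>x. (norm (gradient f x))\<^sup>2 \<partial>\<mu>))"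

text \<open>
  The \<open>(W)\<close>-Lyapunov-\<open>\<Psi>\<close>-Sobolev inequality for the functions of \<open>A\<close>. If \<open>\<Psi>\<close> is convex and non-negative
  then \<open>\<Psi>(h) W\<close> and \<open>W \<Psi>''(h) \<Gamma>(h)\<close> are non-negative, and in the presence of a Lyapunov condition
  the negative part of the right-hand integrand is integrable. So a non-integrable right-hand integrand
  has integral \<open>+\<infinity>\<close> and there is nothing to prove; this is why its integrability is a hypothesis
  (Bochner integrals of non-integrable functions are 0), and why the integrability of \<open>\<Psi>(h) W\<close>
  is part of the inequality.
\<close>

definition lyapunov_psi_sobolev ::
  "('a::euclidean_space \<Rightarrow> 'w measure) \<Rightarrow> (real \<Rightarrow> 'w measure) \<Rightarrow> (real \<Rightarrow> 'w \<Rightarrow> 'a) \<Rightarrow>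
   'a measure \<Rightarrow> (('a \<Rightarrow> real) \<Rightarrow> ('a \<Rightarrow> real)) \<Rightarrow> ('a \<Rightarrow> real) set \<Rightarrow>
   (real \<Rightarrow> real) \<Rightarrow> ('a \<Rightarrow> real) \<Rightarrow> bool" where
  "lyapunov_psi_sobolev Pr Fil X \<mu> L A \<Psi> W \<longleftrightarrow>
     W \<in> extended_domain Pr Fil X \<and> (\<forall>x. 1 \<le> W x) \<and>
     (\<exists>C>0. \<forall>h\<in>A. (\<forall>x. 0 \<le> h x) \<longrightarrow> (\<integral>x. h x \<partial>\<mu>) = 1 \<longrightarrow>
        integrable \<mu> (\<lambda>x. 1/2 * W x * deriv (deriv \<Psi>) (h x) * carre_du_champ L h h x - \<Psi> (h x) * L W x) \<longrightarrow>
        integrable \<mu> (\<lambda>x. \<Psi> (h x) * W x) \<and>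
        (\<integral>x. \<Psi> (h x) * W x \<partial>\<mu>)
          \<le> C * (\<integral>x. 1/2 * W x * deriv (deriv \<Psi>) (h x) * carre_du_champ L h h x - \<Psi> (h x) * L W x \<partial>\<mu>))"

text \<open>
  Only the values on \<open>{0..}\<close> matter; the quadratic branch is used on the negative half-line as well, so that
  the two-sided derivatives exist at 0.
\<close>

definition Psi :: "real \<Rightarrow> real" where
  "Psi u = (if u \<le> 2 then (u - 1)\<^sup>2
            else 1 + (2 - 4 * ln 2) * (u - 2) + 4 * (u * ln u - u - 2 * ln 2 + 2))"

lemma DERIV_Psi:
  "DERIV Psi u :> (if u \<le> 2 then 2 * (u - 1) else 2 - 4 * ln 2 + 4 * ln u)"
proof -
  have "((\<lambda>u. if u \<in> {..2} then (u - 1)\<^sup>2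
            else 1 + (2 - 4 * ln 2) * (u - 2) + 4 * (u * ln u - u - 2 * ln 2 + 2)) has_vector_derivative
        (if u \<in> {..2} then 2 * (u - 1) else 2 - 4 * ln 2 + 4 * ln u)) (at u within UNIV)"
    by (rule has_vector_derivative_If_within_closures[where T="{2..}"])
       (auto intro!: derivative_eq_intros simp: has_real_derivative_iff_has_vector_derivative[symmetric]
             closure_greaterThan closure_closed set_eq_iff algebra_simps)
  then show ?thesis
    unfolding has_real_derivative_iff_has_vector_derivative by (simp add: Psi_def[abs_def])
qed

lemma DERIV_deriv_Psi:
  "DERIV (deriv Psi) u :> (if u \<le> 2 then 2 else 4 / u)"
proof -
  have eq: "deriv Psi = (\<lambda>u. if u \<le> 2 then 2 * (u - 1) else 2 - 4 * ln 2 + 4 * ln u)"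
    by (rule ext, rule DERIV_imp_deriv, rule DERIV_Psi)
  have "((\<lambda>u. if u \<in> {..2} then 2 * (u - 1) else 2 - 4 * ln 2 + 4 * ln u) has_vector_derivative
        (if u \<in> {..2} then 2 else 4 / u)) (at u within UNIV)"
    by (rule has_vector_derivative_If_within_closures[where T="{2..}"])
       (auto intro!: derivative_eq_intros simp: has_real_derivative_iff_has_vector_derivative[symmetric]
             closure_greaterThan closure_closed set_eq_iff algebra_simps)
  then show ?thesis
    unfolding has_real_derivative_iff_has_vector_derivative by (simp add: eq)
qed

lemma deriv_deriv_Psi: "deriv (deriv Psi) u = (if u \<le> 2 then 2 else 4 / u)"
  by (rule DERIV_imp_deriv, rule DERIV_deriv_Psi)

end

(*
  Up to constants Psi is a relative entropy of h + 2, and Psi'' is 1 / (h + 2). On a cube, where mu is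
  comparable to Lebesgue measure, the logarithmic Sobolev inequality (an elementary one-dimensional
  bound plus tensorization) therefore controls the integral of Psi(h) by that of Psi''(h) |grad h|^2 plus
  a function of the mean of h over the cube. Taking lambda large makes the gradient term harmless.
  Since the integral of h is 1, a mean away from 1 forces h - 1 to carry mass outside the cube, and
  if the cube has almost full measure this is expensive for the integral of Psi(h), which the drift
  term - Psi(h) LV controls because V >= 1.
*)

theory Submission
  imports Defs
begin

text \<open>The order of the constants shapes the proof. The drift leaves \<open>max b 0\<close>
  times the integral of \<open>Psi (h x)\<close> over a compact set; this coefficient may be far
  larger than \<open>\<alpha>\<close>, and the entropy bound on a cube leaves a term in the mean of
  \<open>h\<close> that no gradient sees. Let delta be the integral of \<open>h x - 1\<close> over
  the cube. By \<open>ent_gap_le_square\<close> the mean term is at most a constant times delta^2.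
  The complement carries -delta, and there the dual inequality of the entropy bounds 2 S delta^2 by
  the integral of \<open>Psi (h x)\<close>, with \<open>S\<close> as large as desired once the
  complement has mass at most of order exp(-S) / S. So \<open>S\<close> is chosen from the ratio of
  the two coefficients, then the cube from \<open>S\<close>, then \<open>k\<close> from the
  logarithmic Sobolev constant of the cube, however bad, and only then lambda >= 2 k; none of these
  depends on \<open>h\<close>. The shift by 2 keeps the argument of the logarithm away from 0 where
  \<open>h\<close> vanishes. It moves the zero of \<open>Psi\<close> from 1 to 3, which is the
  origin of the base point in \<open>ent_gap 3\<close>.\<close>

section \<open>The function \<open>Psi\<close> and the relative entropy\<close>


text \<open>The Bregman divergence of x ln x from the base point \<open>c\<close>. The affine
  correction makes it non-negative with a double zero at \<open>c\<close>; averaged over a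
  probability measure for which \<open>x\<close> has mean \<open>c\<close>, it gives the
  entropy.\<close>

definition ent_gap :: "real \<Rightarrow> real \<Rightarrow> real" where
  "ent_gap c x = x * ln (x / c) - x + c"

lemma ent_gap_eq: "0 < c \<Longrightarrow> 0 < x \<Longrightarrow> ent_gap c x = x * ln x - x * ln c - x + c"
  by (simp add: ent_gap_def ln_div algebra_simps)

lemma ent_gap_nonneg:
  assumes "0 < c" "0 < x"
  shows "0 \<le> ent_gap c x"
proof -
  have "ln (c / x) \<le> c / x - 1"
    using assms by (intro ln_le_minus_one) simp
  then have "x * ln (c / x) \<le> x * (c / x - 1)"
    using assms by (intro mult_left_mono) auto
  then show ?thesis
    using assms by (simp add: ent_gap_eq ln_div algebra_simps)
qed

lemma ent_gap_le_square:
  assumes "0 < c" "0 < x"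
  shows "ent_gap c x \<le> (x - c)\<^sup>2 / c"
proof -
  have "x * ln (x / c) \<le> x * (x / c - 1)"
    using assms by (intro mult_left_mono ln_le_minus_one) auto
  then show ?thesis
    using assms by (simp add: ent_gap_def field_simps power2_eq_square)
qed

text \<open>Young's inequality: as functions of \<open>x - c\<close> and \<open>s\<close>, the two
  terms on the right are Legendre conjugates. It is non-negativity of the divergence with the base
  point moved to \<open>c * exp s\<close>.\<close>

lemma ent_gap_dual:
  assumes "0 < c" "0 < x"
  shows "s * (x - c) \<le> ent_gap c x + c * (exp s - 1 - s)"
  using ent_gap_nonneg[of "c * exp s" x] assms
  by (simp add: ent_gap_eq ln_mult algebra_simps)

text \<open>Makes the conjugate term of \<open>ent_gap_dual\<close> quadratic for bounded
  \<open>s\<close>. Both signs start from \<open>exp s - 1 \<le> s * exp s\<close>, which leaves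
  \<open>s * (exp s - 1)\<close> to be estimated.\<close>

lemma exp_minus_affine_le:
  fixes s :: real
  assumes "\<bar>s\<bar> \<le> S"
  shows "exp s - 1 - s \<le> exp S * s\<^sup>2"
proof -
  have "1 - s \<le> exp (- s)" "1 + s \<le> exp s" using exp_ge_add_one_self[of "-s"] exp_ge_add_one_self[of s] by simp_all
  have "exp s * (1 - s) \<le> exp s * exp (- s)"
    using \<open>1 - s \<le> exp (- s)\<close> by (intro mult_left_mono) auto
  then have *: "exp s - 1 \<le> s * exp s" by (simp add: exp_minus algebra_simps)
  show ?thesis
  proof (cases "0 \<le> s")
    case True
    have "exp s - 1 - s \<le> s * (exp s - 1)" using * by (simp add: algebra_simps)
    also have "\<dots> \<le> s * (s * exp s)" using * True by (intro mult_left_mono)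
    also have "\<dots> \<le> s * (s * exp S)" using assms True by (intro mult_left_mono) auto
    finally show ?thesis by (simp add: power2_eq_square mult_ac)
  next
    case False
    have "exp s - 1 - s \<le> s * (exp s - 1)" using * by (simp add: algebra_simps)
    also have "\<dots> \<le> s * s" using False \<open>1 + s \<le> exp s\<close> by (intro mult_left_mono_neg) linarith+
    also have "\<dots> \<le> exp S * (s * s)" using assms False mult_right_mono[of 1 "exp S" "s * s"] by auto
    finally show ?thesis by (simp add: power2_eq_square mult_ac)
  qed
qed

lemma DERIV_ent_gap:
  assumes "0 < c" "0 < x"
  shows "DERIV (ent_gap c) x :> ln (x / c)"
  unfolding ent_gap_def [abs_def] using assms
  by (auto intro!: derivative_eq_intros simp: field_simps)

text \<open>The difference \<open>g - f\<close> is convex and its tangent at \<open>a\<close> is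
  zero, so it lies above zero.\<close>

lemma second_derivative_comparison:
  fixes f g :: "real \<Rightarrow> real"
  assumes "convex C"
    and f: "\<And>x. x \<in> C \<Longrightarrow> DERIV f x :> f' x" "\<And>x. x \<in> C \<Longrightarrow> DERIV f' x :> f'' x"
    and g: "\<And>x. x \<in> C \<Longrightarrow> DERIV g x :> g' x" "\<And>x. x \<in> C \<Longrightarrow> DERIV g' x :> g'' x"
    and le: "\<And>x. x \<in> C \<Longrightarrow> f'' x \<le> g'' x"
    and a: "a \<in> C" "f a = g a" "f' a = g' a" and x: "x \<in> C"
  shows "f x \<le> g x"
proof -
  have "(g' a - f' a) * (x - a) \<le> (g x - f x) - (g a - f a)"
    by (rule f''_imp_f'[where f = "\<lambda>x. g x - f x" and f' = "\<lambda>x. g' x - f' x"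
          and f'' = "\<lambda>x. g'' x - f'' x" and C = C])
       (use assms in \<open>auto intro!: derivative_eq_intros\<close>)
  then show ?thesis using a by simp
qed

text \<open>On the half-line, the second derivative of \<open>Psi\<close> lies between \<open>4 / (u + 2)\<close> and
  \<open>8 / (u + 2)\<close>.\<close>

lemma Psi_ent_gap_bounds:
  assumes "0 \<le> u"
  shows "4 * ent_gap 3 (u + 2) \<le> Psi u" "Psi u \<le> 8 * ent_gap 3 (u + 2)"
proof -
  have *: "DERIV (\<lambda>u. k * ent_gap 3 (u + 2)) u :> k * ln ((u + 2) / 3)"
          "DERIV (\<lambda>u. k * ln ((u + 2) / 3)) u :> k / (u + 2)" if "u \<in> {0..}" for k u :: real
    using that by (auto intro!: derivative_eq_intros DERIV_chain2[OF DERIV_ent_gap] simp: field_simps)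
  have D: "DERIV (deriv Psi) u :> (if u \<le> 2 then 2 else 4 / u)" for u
    by (rule DERIV_deriv_Psi)
  have D1: "DERIV Psi u :> deriv Psi u" for u
    using DERIV_Psi[of u] by (metis DERIV_imp_deriv)
  \<comment> \<open>All functions compared have value and derivative zero at \<open>u = 1\<close>,
    where \<open>u + 2 = 3\<close>. The factor 4 is tight for the second derivatives at
    \<open>u = 0\<close>, the factor 8 at \<open>u = 2\<close>.\<close>
  have at1: "deriv Psi 1 = 0" "Psi 1 = 0" "ent_gap 3 3 = 0"
    using DERIV_imp_deriv[OF DERIV_Psi, of 1] by (simp_all add: Psi_def ent_gap_def)
  show "4 * ent_gap 3 (u + 2) \<le> Psi u"
    by (rule second_derivative_comparison[OF convex_real_interval(1)[of 0] * D1 D _ _ _ _, where a = 1])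
       (use assms at1 in \<open>auto simp: field_simps\<close>)
  show "Psi u \<le> 8 * ent_gap 3 (u + 2)"
    by (rule second_derivative_comparison[OF convex_real_interval(1)[of 0] D1 D * _ _ _ _, where a = 1])
       (use assms at1 in \<open>auto simp: field_simps\<close>)
qed

lemma Psi_nonneg: "0 \<le> u \<Longrightarrow> 0 \<le> Psi u"
  using Psi_ent_gap_bounds(1)[of u] ent_gap_nonneg[of 3 "u + 2"] by linarith

section \<open>The logarithmic Sobolev inequality on an interval\<close>

lemma (in prob_space) square_expectation_le:
  fixes f :: "'a \<Rightarrow> real"
  assumes "integrable M f" "integrable M (\<lambda>x. (f x)\<^sup>2)"
  shows "(expectation f)\<^sup>2 \<le> expectation (\<lambda>x. (f x)\<^sup>2)"
  using variance_eq[OF assms] variance_positive[of f] by simp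

lemma set_lebesgue_integral_uniform_measure:
  fixes f :: "'a::euclidean_space \<Rightarrow> real"
  assumes "S \<in> sets lborel" "0 < measure lborel S" "f \<in> borel_measurable borel"
  shows "(\<integral>x. f x \<partial>uniform_measure lborel S) = (LINT x:S|lborel. f x) / measure lborel S"
proof -
  have fin: "emeasure lborel S \<noteq> \<infinity>" "emeasure lborel S \<noteq> 0"
    using assms(2) by (auto simp: measure_def)
  then have e: "emeasure lborel S = ennreal (measure lborel S)"
    using emeasure_eq_ennreal_measure by auto
  have "uniform_measure lborel S = density lborel (\<lambda>x. ennreal (indicator S x / measure lborel S))"
    unfolding uniform_measure_def e
    by (intro arg_cong[where f="density lborel"] ext) (use assms(2) in \<open>auto simp: divide_ennreal simp flip: ennreal_1 split: split_indicator\<close>)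
  moreover have "(\<integral>x. f x \<partial>density lborel (\<lambda>x. ennreal (indicator S x / measure lborel S))) =
     (\<integral>x. (indicator S x / measure lborel S) * f x \<partial>lborel)"
    using assms by (subst integral_density) auto
  ultimately show ?thesis
    by (simp add: set_lebesgue_integral_def)
qed

text \<open>In one dimension the oscillation of \<open>sqrt f\<close> is controlled by the integral
  of its derivative, which is all that the bound needs. \<open>g\<close> and \<open>D\<close> are
  separate from \<open>f\<close> because the application to the cube composes functions with a
  clamp: they are Borel everywhere but follow the smooth function only on the interval.\<close>

lemma log_sobolev_interval:
  fixes f f' g :: "real \<Rightarrow> real"
  assumes ab: "a < b"
    and f': "\<And>x. a \<le> x \<Longrightarrow> x \<le> b \<Longrightarrow> DERIV f x :> f' x"
    and contf': "continuous_on {a..b} f'"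
    and pos: "\<And>x. a \<le> x \<Longrightarrow> x \<le> b \<Longrightarrow> 0 < f x"
    and g: "g \<in> borel_measurable borel" "\<And>x. a \<le> x \<Longrightarrow> x \<le> b \<Longrightarrow> g x = f x"
    and D: "D \<in> borel_measurable borel" "\<And>x. a \<le> x \<Longrightarrow> x \<le> b \<Longrightarrow> D x = (f' x)\<^sup>2 / f x"
  defines "U \<equiv> uniform_measure lborel {a..b}"
  shows "(\<integral>x. g x * ln (g x) \<partial>U) - (\<integral>x. g x \<partial>U) * ln (\<integral>x. g x \<partial>U) \<le> (b - a)\<^sup>2 * (\<integral>x. D x \<partial>U)"
proof -
  interpret U: prob_space U
    unfolding U_def using ab by (intro prob_space_uniform_measure) auto
  have AEU: "AE x in U. x \<in> {a..b}"
    unfolding U_def by (rule AE_uniform_measureI) auto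
  have contf: "continuous_on {a..b} f"
    by (rule DERIV_continuous_on[OF DERIV_subset]) (use f' in auto)
  have setsU: "sets U = sets borel" unfolding U_def by simp
  have int: "integrable U u" if that': "u \<in> borel_measurable borel" "continuous_on {a..b} v"
    "\<And>x. a \<le> x \<Longrightarrow> x \<le> b \<Longrightarrow> u x = v x" for u v :: "real \<Rightarrow> real"
  proof -
    obtain B where B: "\<And>x. x \<in> {a..b} \<Longrightarrow> norm (v x) \<le> B"
      using compact_imp_bounded[OF compact_continuous_image[OF that'(2) compact_Icc]]
      unfolding bounded_iff by force
    show ?thesis
      by (rule U.integrable_const_bound[where B=B])
         (use AEU B that' in \<open>auto simp: measurable_cong_sets[OF setsU refl]\<close>)
  qed
  have cont_ln: "continuous_on {a..b} (\<lambda>x. f x * ln (f x))"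
    using contf pos by (intro continuous_intros) (auto simp: less_imp_neq[symmetric])
  \<comment> \<open>The derivative of \<open>sqrt f\<close>, so that its square is
    \<open>D / 4\<close> on the interval. Its cut-off \<open>e\<close> below is Borel on the whole
    line.\<close>
  define d where "d x = f' x / (2 * sqrt (f x))" for x
  have contd: "continuous_on {a..b} d"
    unfolding d_def using pos by (intro continuous_intros contf contf') (auto simp: less_imp_neq[symmetric])
  define e where "e x = indicator {a..b} x * d x" for x
  have e_eq: "e x = d x" if "a \<le> x" "x \<le> b" for x
    using that by (simp add: e_def)
  have e_meas: "e \<in> borel_measurable borel"
    unfolding e_def using borel_measurable_continuous_on_indicator[OF _ contd] by (simp add: mult_ac)
  have sqD: "(\<integral>x. (e x)\<^sup>2 \<partial>U) = (\<integral>x. D x \<partial>U) / 4"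
  proof -
    have "(\<integral>x. (e x)\<^sup>2 \<partial>U) = (\<integral>x. D x / 4 \<partial>U)"
    proof (rule integral_cong_AE)
      show "AE x in U. (e x)\<^sup>2 = D x / 4"
        using AEU
      proof eventually_elim
        case (elim x)
        then show ?case using D pos[of x]
          by (simp add: e_def d_def power_divide power_mult_distrib less_imp_le)
      qed
    qed (use D e_meas in \<open>auto simp: measurable_cong_sets[OF setsU refl]\<close>)
    then show ?thesis by simp
  qed
  \<comment> \<open>The fundamental theorem of calculus bounds the increment by \<open>b - a\<close>
    times the mean of \<open>\<bar>e x\<bar>\<close>; Jensen's inequality then turns the squared
    mean into the mean of the square.\<close>
  have osc: "(sqrt (f x) - sqrt (f y))\<^sup>2 \<le> (b - a)\<^sup>2 / 4 * (\<integral>x. D x \<partial>U)"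
    if "x \<in> {a..b}" "y \<in> {a..b}" for x y
  proof -
    have main: "\<bar>sqrt (f y) - sqrt (f x)\<bar> \<le> (b - a) * (\<integral>x. \<bar>e x\<bar> \<partial>U)" if xy: "a \<le> x" "x \<le> y" "y \<le> b" for x y
    proof -
      have sub: "{x..y} \<subseteq> {a..b}" using xy by auto
      have "(\<integral>t. indicator {x..y} t *\<^sub>R d t \<partial>lborel) = sqrt (f y) - sqrt (f x)"
      proof (rule integral_FTC_atLeastAtMost)
        fix t assume t: "x \<le> t" "t \<le> y"
        have "((\<lambda>x. sqrt (f x)) has_real_derivative d t) (at t within {x..y})"
          unfolding d_def using f'[of t] pos[of t] t xy
          by (auto intro!: derivative_eq_intros DERIV_subset[OF f'] simp: field_simps)
        then show "((\<lambda>x. sqrt (f x)) has_vector_derivative d t) (at t within {x..y})"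
          by (simp add: has_real_derivative_iff_has_vector_derivative)
      qed (use xy continuous_on_subset[OF contd sub] in auto)
      then have "\<bar>sqrt (f y) - sqrt (f x)\<bar> \<le> (\<integral>t. \<bar>indicator {x..y} t *\<^sub>R d t\<bar> \<partial>lborel)"
        using integral_abs_bound[of lborel "\<lambda>t. indicator {x..y} t *\<^sub>R d t"] by simp
      also have "\<dots> \<le> (\<integral>t. indicator {a..b} t * \<bar>e t\<bar> \<partial>lborel)"
      proof (rule integral_mono)
        show "integrable lborel (\<lambda>t. \<bar>indicator {x..y} t *\<^sub>R d t\<bar>)"
          using borel_integrable_atLeastAtMost'[OF continuous_on_subset[OF contd sub]]
          unfolding set_integrable_def by simp
        have "integrable lborel (\<lambda>t. \<bar>indicator {a..b} t *\<^sub>R d t\<bar>)"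
          using borel_integrable_atLeastAtMost'[OF contd]
          unfolding set_integrable_def by simp
        then show "integrable lborel (\<lambda>t. indicator {a..b} t * \<bar>e t\<bar>)"
          by (rule Bochner_Integration.integrable_cong[THEN iffD1, rotated 2]) (auto simp: e_def split: split_indicator)
      qed (use sub in \<open>auto simp: e_def split: split_indicator\<close>)
      also have "\<dots> = (b - a) * (\<integral>x. \<bar>e x\<bar> \<partial>U)"
        using ab e_meas unfolding U_def
        by (subst set_lebesgue_integral_uniform_measure) (auto simp: set_lebesgue_integral_def)
      finally show ?thesis .
    qed
    have "\<bar>sqrt (f x) - sqrt (f y)\<bar> \<le> (b - a) * (\<integral>x. \<bar>e x\<bar> \<partial>U)"
    proof (cases "x \<le> y")
      case True
      then show ?thesis using main[of x y] that by (simp add: abs_minus_commute)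
    next
      case False
      then show ?thesis using main[of y x] that by simp
    qed
    then have "\<bar>sqrt (f x) - sqrt (f y)\<bar>\<^sup>2 \<le> ((b - a) * (\<integral>x. \<bar>e x\<bar> \<partial>U))\<^sup>2"
      by (rule power_mono) simp
    also have "\<dots> \<le> (b - a)\<^sup>2 * (\<integral>x. \<bar>e x\<bar>\<^sup>2 \<partial>U)"
      unfolding power_mult_distrib
    proof (intro mult_left_mono U.square_expectation_le)
      show "integrable U (\<lambda>x. \<bar>e x\<bar>)"
        by (rule int[of _ "\<lambda>x. \<bar>d x\<bar>"])
           (use contd e_meas in \<open>auto intro!: continuous_intros simp: e_eq\<close>)
      show "integrable U (\<lambda>x. \<bar>e x\<bar>\<^sup>2)"
        by (rule int[of _ "\<lambda>x. \<bar>d x\<bar>\<^sup>2"])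
           (use contd e_meas in \<open>auto intro!: continuous_intros simp: e_eq\<close>)
    qed simp
    finally show ?thesis using sqD by simp
  qed
  \<comment> \<open>The entropy is at most the integral of \<open>(f - c)\<^sup>2 / c\<close> for every \<open>c > 0\<close>. For \<open>c = max f\<close> this is at
    most \<open>4 (sqrt f - sqrt c)\<^sup>2\<close>, and the oscillation bound applies.\<close>
  obtain y where y: "y \<in> {a..b}" "\<And>x. x \<in> {a..b} \<Longrightarrow> f x \<le> f y"
    using continuous_attains_sup[OF compact_Icc _ contf] ab by auto
  define c where "c = f y"
  have c: "0 < c" using pos y unfolding c_def by auto
  have Eg: "integrable U g" by (rule int[of _ f]) (use g contf in auto)
  have Egl: "integrable U (\<lambda>x. g x * ln (g x))" by (rule int[of _ "\<lambda>x. f x * ln (f x)"]) (use g cont_ln in auto)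
  define m where "m = (\<integral>x. g x \<partial>U)"
  have "m > 0"
  proof -
    obtain z where z: "z \<in> {a..b}" "\<And>x. x \<in> {a..b} \<Longrightarrow> f z \<le> f x"
      using continuous_attains_inf[OF compact_Icc _ contf] ab by auto
    have "f z \<le> m" unfolding m_def
    proof (rule U.integral_ge_const[OF Eg])
      show "AE x in U. f z \<le> g x"
        using AEU by eventually_elim (use z g in auto)
    qed
    then show ?thesis using pos z by force
  qed
  have "(\<integral>x. g x * ln (g x) \<partial>U) - m * ln m \<le> (\<integral>x. g x * ln (g x) \<partial>U) - m * ln c - m + c"
    using ent_gap_nonneg[OF c \<open>m > 0\<close>] ent_gap_eq[OF c \<open>m > 0\<close>] by simp
  also have "\<dots> = (\<integral>x. g x * ln (g x) - ln c * g x - g x + c \<partial>U)"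
    using Eg Egl by (simp add: m_def U.prob_space)
  also have "\<dots> \<le> (\<integral>x. (b - a)\<^sup>2 * (\<integral>x. D x \<partial>U) \<partial>U)"
  proof (rule integral_mono_AE)
    show "AE x in U. g x * ln (g x) - ln c * g x - g x + c \<le> (b - a)\<^sup>2 * (\<integral>x. D x \<partial>U)"
      using AEU
    proof eventually_elim
      case (elim x)
      define s where "s = sqrt (f x)"
      define t where "t = sqrt c"
      have st: "0 < s" "s \<le> t" "f x = s\<^sup>2" "c = t\<^sup>2"
        using pos elim y c unfolding s_def t_def c_def by (auto simp: less_imp_le)
      have "g x * ln (g x) - ln c * g x - g x + c = ent_gap c (f x)"
        using g elim c pos by (simp add: ent_gap_eq)
      also have "\<dots> \<le> (f x - c)\<^sup>2 / c" using elim pos c by (intro ent_gap_le_square) auto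
      also have "\<dots> = (s - t)\<^sup>2 * ((s + t)\<^sup>2 / t\<^sup>2)"
        unfolding st by (simp add: power2_eq_square algebra_simps)
      also have "\<dots> \<le> (s - t)\<^sup>2 * 4"
      proof (rule mult_left_mono)
        have "(s + t)\<^sup>2 \<le> (2 * t)\<^sup>2" using st by (intro power_mono) auto
        then show "(s + t)\<^sup>2 / t\<^sup>2 \<le> 4" using st by (simp add: field_simps)
      qed simp
      also have "\<dots> \<le> (b - a)\<^sup>2 * (\<integral>x. D x \<partial>U)"
        using osc[of x y] elim y unfolding s_def t_def c_def by simp
      finally show ?case .
    qed
  qed (use Eg Egl in auto)
  also have "\<dots> = (b - a)\<^sup>2 * (\<integral>x. D x \<partial>U)" by (simp add: U.prob_space)
  finally show ?thesis by (simp add: m_def)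
qed


section \<open>Tensorization\<close>

lemma (in prob_space) integrable_between:
  fixes f :: "'a \<Rightarrow> real"
  assumes "f \<in> borel_measurable M" "\<And>x. x \<in> space M \<Longrightarrow> a \<le> f x" "\<And>x. x \<in> space M \<Longrightarrow> f x \<le> b"
  shows "integrable M f"
  using assms by (intro integrable_const_bound[where B = "max \<bar>a\<bar> \<bar>b\<bar>"]) (force intro!: AE_I2)+

lemma abs_ln_le:
  fixes c C x :: real
  assumes "0 < c" "c \<le> x" "x \<le> C"
  shows "\<bar>ln x\<bar> \<le> \<bar>ln c\<bar> + \<bar>ln C\<bar>"
proof -
  have "ln c \<le> ln x" "ln x \<le> ln C" using assms by auto
  then show ?thesis by linarith
qed

lemma xlnx_bounds:
  fixes c C x :: real
  assumes "0 < c" "c \<le> x" "x \<le> C"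
  shows "- (C * (\<bar>ln c\<bar> + \<bar>ln C\<bar>)) \<le> x * ln x" "x * ln x \<le> C * (\<bar>ln c\<bar> + \<bar>ln C\<bar>)"
proof -
  have "\<bar>ln x\<bar> \<le> \<bar>ln c\<bar> + \<bar>ln C\<bar>"
    by (rule abs_ln_le[OF assms])
  then have "\<bar>x * ln x\<bar> \<le> C * (\<bar>ln c\<bar> + \<bar>ln C\<bar>)"
    unfolding abs_mult using assms by (intro mult_mono) auto
  then show "- (C * (\<bar>ln c\<bar> + \<bar>ln C\<bar>)) \<le> x * ln x" "x * ln x \<le> C * (\<bar>ln c\<bar> + \<bar>ln C\<bar>)"
    by auto
qed

lemma (in prob_space) integral_between:
  fixes f :: "'a \<Rightarrow> real"
  assumes "f \<in> borel_measurable M" "\<And>x. x \<in> space M \<Longrightarrow> a \<le> f x" "\<And>x. x \<in> space M \<Longrightarrow> f x \<le> b"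
  shows "a \<le> expectation f" "expectation f \<le> b"
  using integral_ge_const[of f a] integral_le_const[of f b] integrable_between[OF assms] assms
  by (auto intro!: AE_I2)

text \<open>One half of the variational formula for the entropy, the supremum of the integrals of f
  ln (g / E g). Take the divergence of \<open>f\<close> from \<open>g\<close> rescaled by
  \<open>a / b\<close>: both functions then have the same mean, so the affine corrections cancel on
  integration.\<close>

lemma (in prob_space) entropy_ge:
  fixes f g :: "'a \<Rightarrow> real"
  assumes f: "f \<in> borel_measurable M" "\<And>x. x \<in> space M \<Longrightarrow> c \<le> f x" "\<And>x. x \<in> space M \<Longrightarrow> f x \<le> C"
    and g: "g \<in> borel_measurable M" "\<And>x. x \<in> space M \<Longrightarrow> c \<le> g x" "\<And>x. x \<in> space M \<Longrightarrow> g x \<le> C"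
    and c: "0 < c"
  shows "(\<integral>x. f x * ln (g x) \<partial>M) - expectation f * ln (expectation g)
    \<le> (\<integral>x. f x * ln (f x) \<partial>M) - expectation f * ln (expectation f)"
proof -
  define a where "a = expectation f"
  define b where "b = expectation g"
  have a: "0 < a" using integral_between(1)[OF f] c by (simp add: a_def)
  have b: "0 < b" using integral_between(1)[OF g] c by (simp add: b_def)
  define h where "h x = a / b * g x" for x
  have If: "integrable M f" by (rule integrable_between[OF f])
  have Ig: "integrable M g" by (rule integrable_between[OF g])
  have Iff: "integrable M (\<lambda>x. f x * ln (f x))"
    by (rule integrable_between[OF _ xlnx_bounds[OF c]]) (use f in auto)
  have Ifg: "integrable M (\<lambda>x. f x * ln (g x))"
  proof (rule integrable_const_bound)
    show "AE x in M. norm (f x * ln (g x)) \<le> C * (\<bar>ln c\<bar> + \<bar>ln C\<bar>)"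
    proof (rule AE_I2)
      fix x assume x: "x \<in> space M"
      have "\<bar>ln (g x)\<bar> \<le> \<bar>ln c\<bar> + \<bar>ln C\<bar>"
        by (rule abs_ln_le[OF c g(2,3)[OF x]])
      then show "norm (f x * ln (g x)) \<le> C * (\<bar>ln c\<bar> + \<bar>ln C\<bar>)"
        unfolding real_norm_def abs_mult using c f(2,3)[OF x] by (intro mult_mono) auto
    qed
  qed (use f g in auto)
  have "0 \<le> (\<integral>x. f x * ln (f x) - f x * ln (g x) - (ln a - ln b) * f x - f x + a / b * g x \<partial>M)"
  proof (rule integral_nonneg_AE, rule AE_I2)
    fix x assume x: "x \<in> space M"
    have p: "0 < f x" "0 < g x" using f(2)[OF x] g(2)[OF x] c by auto
    have "0 \<le> ent_gap (a / b * g x) (f x)"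
      using p a b by (intro ent_gap_nonneg) auto
    also have "\<dots> = f x * ln (f x) - f x * ln (g x) - (ln a - ln b) * f x - f x + a / b * g x"
      using p a b ent_gap_eq[of "a / b * g x" "f x"] by (simp add: ln_mult ln_div algebra_simps)
    finally show "0 \<le> f x * ln (f x) - f x * ln (g x) - (ln a - ln b) * f x - f x + a / b * g x" .
  qed
  also have "\<dots> = (\<integral>x. f x * ln (f x) \<partial>M) - (\<integral>x. f x * ln (g x) \<partial>M) - (ln a - ln b) * a - a + a / b * b"
    using If Ig Iff Ifg by (simp add: a_def[symmetric] b_def[symmetric])
  finally show ?thesis using b by (simp add: a_def[symmetric] b_def[symmetric] algebra_simps)
qed

lemma measurable_fun_upd_PiM:
  "(\<lambda>p. (fst p)(j := snd p)) \<in> measurable (PiM I M \<Otimes>\<^sub>M M j) (PiM (insert j I) M)"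
  using measurable_add_dim[of j I M] by (simp add: case_prod_beta')

text \<open>Subadditivity of entropy, with the coordinate entropies already replaced by bounds
  \<open>G i\<close>. For a new coordinate \<open>j\<close>, the entropy splits exactly into the
  average entropy of the slices with \<open>j\<close> fixed and the entropy of the slice means. The
  induction hypothesis bounds the first, \<open>entropy_ge\<close> the second. The uniform bounds on
  \<open>f\<close> and \<open>G\<close> supply every integrability that Fubini's theorem asks
  for.\<close>

lemma (in prob_space) entropy_tensorization:
  fixes f :: "('i \<Rightarrow> 'a) \<Rightarrow> real" and G :: "'i \<Rightarrow> ('i \<Rightarrow> 'a) \<Rightarrow> real"
  defines "P \<equiv> \<lambda>I. PiM I (\<lambda>_. M)"
  assumes "finite I"
    and "f \<in> borel_measurable (P I)" "0 < c"
    and "\<And>x. x \<in> space (P I) \<Longrightarrow> c \<le> f x" "\<And>x. x \<in> space (P I) \<Longrightarrow> f x \<le> C"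
    and "\<And>i. i \<in> I \<Longrightarrow> G i \<in> borel_measurable (P I)"
    and "\<And>i x. i \<in> I \<Longrightarrow> x \<in> space (P I) \<Longrightarrow> \<bar>G i x\<bar> \<le> B"
    and "\<And>i x. i \<in> I \<Longrightarrow> x \<in> space (P I) \<Longrightarrow>
      (\<integral>t. f (x(i:=t)) * ln (f (x(i:=t))) \<partial>M) - (\<integral>t. f (x(i:=t)) \<partial>M) * ln (\<integral>t. f (x(i:=t)) \<partial>M)
      \<le> (\<integral>t. G i (x(i:=t)) \<partial>M)"
  shows "(\<integral>x. f x * ln (f x) \<partial>P I) - (\<integral>x. f x \<partial>P I) * ln (\<integral>x. f x \<partial>P I) \<le> (\<Sum>i\<in>I. \<integral>x. G i x \<partial>P I)"
  using assms(2-)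
proof (induction I arbitrary: f G rule: finite_induct)
  case empty
  have "(\<integral>x. h x \<partial>P {}) = h (\<lambda>_. undefined)" for h :: "('i \<Rightarrow> 'a) \<Rightarrow> real"
    unfolding P_def PiM_empty by (subst lebesgue_integral_count_space_finite) auto
  then show ?case by simp
next
  case (insert j I)
  note f = insert.prems(1,3,4) and c = insert.prems(2) and G = insert.prems(5,6,7)
  interpret PS: product_sigma_finite "\<lambda>_. M" by standard
  interpret PP: product_prob_space "\<lambda>_. M" "I" by standard
  interpret PJ: product_prob_space "\<lambda>_. M" "insert j I" by standard
  interpret PI: prob_space "P I" unfolding P_def by (rule PP.prob_space_axioms)
  interpret PJI: prob_space "P (insert j I)" unfolding P_def by (rule PJ.prob_space_axioms)
  interpret pair: pair_prob_space "P I" M by standard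
  have upd: "x(j := t) \<in> space (P (insert j I))" if "x \<in> space (P I)" "t \<in> space M" for x t
    using that by (auto simp: P_def space_PiM PiE_def extensional_def)
  have meas: "(\<lambda>p. h ((fst p)(j := snd p))) \<in> borel_measurable (P I \<Otimes>\<^sub>M M)"
    if "h \<in> borel_measurable (P (insert j I))" for h :: "_ \<Rightarrow> real"
    using measurable_compose[OF measurable_fun_upd_PiM[of j I "\<lambda>_. M"]] that by (simp add: P_def)
  have meas1: "(\<lambda>x. h (x(j := t))) \<in> borel_measurable (P I)"
    if "h \<in> borel_measurable (P (insert j I))" "t \<in> space M" for h :: "_ \<Rightarrow> real" and t
    using measurable_compose[OF measurable_Pair2'[OF that(2), of "P I"] meas[OF that(1)]] by simp
  have meas2: "(\<lambda>t. h (x(j := t))) \<in> borel_measurable M"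
    if "h \<in> borel_measurable (P (insert j I))" "x \<in> space (P I)" for h :: "_ \<Rightarrow> real" and x
    using measurable_compose[OF measurable_Pair1'[OF that(2), of M] meas[OF that(1)]] by simp
  have fub: "(\<integral>x. h x \<partial>P (insert j I)) = (\<integral>x. (\<integral>t. h (x(j := t)) \<partial>M) \<partial>P I)"
     "(\<integral>x. h x \<partial>P (insert j I)) = (\<integral>t. (\<integral>x. h (x(j := t)) \<partial>P I) \<partial>M)"
     "integrable M (\<lambda>t. (\<integral>x. h (x(j := t)) \<partial>P I))"
     "integrable (P I) (\<lambda>x. (\<integral>t. h (x(j := t)) \<partial>M))"
    if h: "h \<in> borel_measurable (P (insert j I))" "\<And>x. x \<in> space (P (insert j I)) \<Longrightarrow> \<bar>h x\<bar> \<le> K"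
    for h :: "_ \<Rightarrow> real" and K
  proof -
    have "integrable (P (insert j I)) h"
      by (rule PJI.integrable_const_bound[of _ K]) (use h in \<open>auto intro!: AE_I2\<close>)
    then show 1: "(\<integral>x. h x \<partial>P (insert j I)) = (\<integral>x. (\<integral>t. h (x(j := t)) \<partial>M) \<partial>P I)"
      unfolding P_def using insert.hyps by (intro PS.product_integral_insert) auto
    have i: "integrable (P I \<Otimes>\<^sub>M M) (\<lambda>(x, t). h (x(j := t)))"
      by (rule pair.integrable_const_bound[of _ K])
         (use h upd meas[OF h(1)] in \<open>auto intro!: AE_I2 simp: space_pair_measure case_prod_beta'\<close>)
    then show "(\<integral>x. h x \<partial>P (insert j I)) = (\<integral>t. (\<integral>x. h (x(j := t)) \<partial>P I) \<partial>M)"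
      unfolding 1 by (rule pair.Fubini_integral[symmetric])
    show "integrable M (\<lambda>t. (\<integral>x. h (x(j := t)) \<partial>P I))"
      using pair.integrable_snd[OF i] by simp
    show "integrable (P I) (\<lambda>x. (\<integral>t. h (x(j := t)) \<partial>M))"
      using pair.integrable_fst[OF i] by simp
  qed
  define K where "K = C * (\<bar>ln c\<bar> + \<bar>ln C\<bar>)"
  define k where "k x = f x * ln (f x)" for x
  have k: "k \<in> borel_measurable (P (insert j I))" "\<And>x. x \<in> space (P (insert j I)) \<Longrightarrow> \<bar>k x\<bar> \<le> K"
    using f xlnx_bounds[OF c f(2,3)] unfolding k_def K_def by (auto simp: abs_le_iff minus_le_iff)
  have f': "f \<in> borel_measurable (P (insert j I))" "\<And>x. x \<in> space (P (insert j I)) \<Longrightarrow> \<bar>f x\<bar> \<le> C"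
    using f c by force+
  define E where "E t = (\<integral>x. f (x(j := t)) \<partial>P I)" for t
  define m where "m = (\<integral>x. f x \<partial>P (insert j I))"
  have m: "m = (\<integral>t. E t \<partial>M)" unfolding m_def E_def by (rule fub(2)[OF f'])
  have E_int: "integrable M E" unfolding E_def by (rule fub(3)[OF f'])
  have E: "E \<in> borel_measurable M" "\<And>t. t \<in> space M \<Longrightarrow> c \<le> E t" "\<And>t. t \<in> space M \<Longrightarrow> E t \<le> C"
    using E_int unfolding E_def
    by (auto intro!: PI.integral_between[OF meas1[OF f(1)], of _ c C] f upd)
  have EE: "\<bar>E t * ln (E t)\<bar> \<le> K" if "t \<in> space M" for t
    using xlnx_bounds[OF c E(2,3)] that unfolding K_def by (auto simp: abs_le_iff minus_le_iff)
  have EE_int: "integrable M (\<lambda>t. E t * ln (E t))"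
    by (rule integrable_const_bound[of _ K]) (use E EE in \<open>auto intro!: AE_I2\<close>)
  have Gfub: "integrable M (\<lambda>t. \<integral>x. G i (x(j := t)) \<partial>P I)"
     "(\<integral>x. G i x \<partial>P (insert j I)) = (\<integral>t. (\<integral>x. G i (x(j := t)) \<partial>P I) \<partial>M)" if "i \<in> insert j I" for i
    by (rule fub(3)[OF G(1)[OF that] G(2)[OF that]], simp) (rule fub(2)[OF G(1)[OF that] G(2)[OF that]])
  have "(\<integral>t. (\<integral>x. k (x(j := t)) \<partial>P I) \<partial>M) - (\<integral>t. E t * ln (E t) \<partial>M)
    = (\<integral>t. (\<integral>x. k (x(j := t)) \<partial>P I) - E t * ln (E t) \<partial>M)"
    by (rule Bochner_Integration.integral_diff[symmetric, OF fub(3)[OF k] EE_int])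
  also have "\<dots> \<le> (\<integral>t. (\<Sum>i\<in>I. \<integral>x. G i (x(j := t)) \<partial>P I) \<partial>M)"
  proof (rule integral_mono)
    show "integrable M (\<lambda>t. (\<integral>x. k (x(j := t)) \<partial>P I) - E t * ln (E t))"
      by (rule Bochner_Integration.integrable_diff[OF fub(3)[OF k] EE_int])
    show "integrable M (\<lambda>t. (\<Sum>i\<in>I. \<integral>x. G i (x(j := t)) \<partial>P I))"
      by (rule Bochner_Integration.integrable_sum) (use Gfub in auto)
    fix t assume t: "t \<in> space M"
    have "(\<integral>x. f (x(j := t)) * ln (f (x(j := t))) \<partial>P I) - (\<integral>x. f (x(j := t)) \<partial>P I) * ln (\<integral>x. f (x(j := t)) \<partial>P I)
        \<le> (\<Sum>i\<in>I. \<integral>x. G i (x(j := t)) \<partial>P I)"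
    proof (rule insert.IH[of "\<lambda>x. f (x(j := t))" "\<lambda>i x. G i (x(j := t))"])
      fix i x assume i: "i \<in> I" and x: "x \<in> space (P I)"
      \<comment> \<open>Since \<open>j\<close> is not in \<open>I\<close>, the two updates commute,
        and the inequality for the slice at \<open>t\<close> becomes the one for the original
        function at the point \<open>x(j := t)\<close>.\<close>
      have tw: "x(i := s, j := t) = x(j := t, i := s)" for s
        using i insert.hyps by (intro fun_upd_twist) auto
      show "(\<integral>s. f (x(i := s, j := t)) * ln (f (x(i := s, j := t))) \<partial>M)
        - (\<integral>s. f (x(i := s, j := t)) \<partial>M) * ln (\<integral>s. f (x(i := s, j := t)) \<partial>M)
        \<le> (\<integral>s. G i (x(i := s, j := t)) \<partial>M)"
        unfolding tw by (rule G(3)) (use i upd[OF x t] in \<open>auto simp: fun_upd_def\<close>)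
    qed (use t c in \<open>auto intro!: f(2,3) G(2) upd meas1[OF f(1)] meas1[OF G(1)]\<close>)
    then show "(\<integral>x. k (x(j := t)) \<partial>P I) - E t * ln (E t) \<le> (\<Sum>i\<in>I. \<integral>x. G i (x(j := t)) \<partial>P I)"
      by (simp add: k_def E_def)
  qed
  also have "\<dots> = (\<Sum>i\<in>I. \<integral>x. G i x \<partial>P (insert j I))"
    using Gfub by (subst Bochner_Integration.integral_sum) auto
  finally have first: "(\<integral>x. k x \<partial>P (insert j I)) - (\<integral>t. E t * ln (E t) \<partial>M)
      \<le> (\<Sum>i\<in>I. \<integral>x. G i x \<partial>P (insert j I))"
    by (simp add: fub(2)[OF k])

  \<comment> \<open>\<open>E (x j)\<close> depends on coordinate \<open>j\<close> alone, so
    averaging \<open>f\<close> over the others shows that \<open>q\<close> has the integral of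
    \<open>E t * ln (E t)\<close>. The form with \<open>q\<close> can be compared, for each fixed
    \<open>x\<close>, with the entropy of \<open>f\<close> in coordinate \<open>j\<close>.\<close>
  define q where "q x = f x * ln (E (x j))" for x
  have "(\<lambda>x. E (x j)) \<in> borel_measurable (P (insert j I))"
    unfolding P_def by (rule measurable_compose[where f = "\<lambda>x. x j" and g = E, OF _ E(1)]) (intro measurable_component_singleton, simp)
  then have qm: "q \<in> borel_measurable (P (insert j I))" using f unfolding q_def by auto
  have qK: "\<bar>q x\<bar> \<le> K" if "x \<in> space (P (insert j I))" for x
  proof -
    have "x j \<in> space M" using that by (auto simp: P_def space_PiM PiE_def Pi_def)
    then have "\<bar>ln (E (x j))\<bar> \<le> \<bar>ln c\<bar> + \<bar>ln C\<bar>"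
      by (intro abs_ln_le[OF c E(2,3)])
    then show "\<bar>q x\<bar> \<le> K"
      unfolding q_def K_def abs_mult using c f(2,3)[OF that] by (intro mult_mono) auto
  qed
  have "(\<integral>t. E t * ln (E t) \<partial>M) = (\<integral>t. (\<integral>x. q (x(j := t)) \<partial>P I) \<partial>M)"
    by (simp add: q_def E_def)
  also have "\<dots> = (\<integral>x. (\<integral>t. q (x(j := t)) \<partial>M) \<partial>P I)"
    using fub(1,2)[OF qm qK] by simp
  finally have "(\<integral>t. E t * ln (E t) \<partial>M) - m * ln m
      = (\<integral>x. (\<integral>t. q (x(j := t)) \<partial>M) \<partial>P I) - (\<integral>x. (\<integral>t. f (x(j := t)) \<partial>M) \<partial>P I) * ln m"
    using fub(1)[OF f'] by (simp add: m_def)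
  also have "\<dots> = (\<integral>x. (\<integral>t. q (x(j := t)) \<partial>M) - (\<integral>t. f (x(j := t)) \<partial>M) * ln m \<partial>P I)"
    using fub(4)[OF qm qK] fub(4)[OF f'] by simp
  also have "\<dots> \<le> (\<integral>x. (\<integral>t. G j (x(j := t)) \<partial>M) \<partial>P I)"
  proof (rule integral_mono)
    show "integrable (P I) (\<lambda>x. (\<integral>t. q (x(j := t)) \<partial>M) - (\<integral>t. f (x(j := t)) \<partial>M) * ln m)"
      using fub(4)[OF qm qK] fub(4)[OF f'] by simp
    show "integrable (P I) (\<lambda>x. \<integral>t. G j (x(j := t)) \<partial>M)"
      by (rule fub(4)[OF G(1) G(2), of j]) simp_all
    fix x assume x: "x \<in> space (P I)"
    \<comment> \<open>A point of the larger product space is required; its coordinate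
      \<open>j\<close> is overwritten at once, so any value serves.\<close>
    obtain t0 where t0: "t0 \<in> space M" using not_empty by auto
    have "(\<integral>t. q (x(j := t)) \<partial>M) - (\<integral>t. f (x(j := t)) \<partial>M) * ln m
      \<le> (\<integral>t. f (x(j := t)) * ln (f (x(j := t))) \<partial>M) - (\<integral>t. f (x(j := t)) \<partial>M) * ln (\<integral>t. f (x(j := t)) \<partial>M)"
      unfolding m q_def fun_upd_same
      by (rule entropy_ge[where c = c and C = C]) (use E c in \<open>auto intro!: f(2,3) upd[OF x] meas2[OF f(1) x]\<close>)
    also have "\<dots> \<le> (\<integral>t. G j (x(j := t)) \<partial>M)"
      using G(3)[OF insertI1 upd[OF x t0]] by (simp only: fun_upd_upd)
    finally show "(\<integral>t. q (x(j := t)) \<partial>M) - (\<integral>t. f (x(j := t)) \<partial>M) * ln m \<le> (\<integral>t. G j (x(j := t)) \<partial>M)" .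
  qed
  also have "\<dots> = (\<integral>x. G j x \<partial>P (insert j I))"
    by (rule fub(1)[OF G(1) G(2), of j, symmetric]) simp_all
  finally show ?case
    using first insert.hyps by (simp add: k_def m_def)
qed


section \<open>The logarithmic Sobolev inequality on a cube\<close>

lemma PiM_uniform_measure_Icc:
  fixes a b :: real and I :: "'i set"
  assumes "a < b" "finite I"
  shows "PiM I (\<lambda>_. uniform_measure lborel {a..b})
    = uniform_measure (PiM I (\<lambda>_. lborel)) (I \<rightarrow>\<^sub>E {a..b})"
proof -
  interpret U: prob_space "uniform_measure lborel {a..b}"
    using assms by (intro prob_space_uniform_measure) auto
  interpret UP: product_sigma_finite "\<lambda>_. uniform_measure lborel {a..b}" by standard
  interpret LP: product_sigma_finite "\<lambda>_. lborel :: real measure" by standard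
  have inv: "inverse (\<Prod>i\<in>I. ennreal (b - a)) = (\<Prod>i\<in>I. inverse (ennreal (b - a)))"
    using assms by (simp add: inverse_ennreal ennreal_power power_inverse)
  show ?thesis
  proof (rule UP.PiM_eqI[symmetric])
    show "sets (uniform_measure (Pi\<^sub>M I (\<lambda>_. lborel)) (I \<rightarrow>\<^sub>E {a..b}))
        = sets (Pi\<^sub>M I (\<lambda>_. uniform_measure lborel {a..b}))"
      unfolding sets_uniform_measure by (rule sets_PiM_cong) auto
    fix A :: "'i \<Rightarrow> real set" assume "\<And>i. i \<in> I \<Longrightarrow> A i \<in> sets (uniform_measure lborel {a..b})"
    then have A: "\<And>i. i \<in> I \<Longrightarrow> A i \<in> sets borel" by simp
    have "emeasure (uniform_measure (Pi\<^sub>M I (\<lambda>_. lborel)) (I \<rightarrow>\<^sub>E {a..b})) (Pi\<^sub>E I A)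
      = emeasure (Pi\<^sub>M I (\<lambda>_. lborel)) (Pi\<^sub>E I (\<lambda>i. {a..b} \<inter> A i)) / emeasure (Pi\<^sub>M I (\<lambda>_. lborel)) (I \<rightarrow>\<^sub>E {a..b})"
      using A assms by (subst emeasure_uniform_measure) (auto intro!: sets_PiM_I_finite simp: PiE_Int)
    also have "\<dots> = (\<Prod>i\<in>I. emeasure lborel ({a..b} \<inter> A i)) / (\<Prod>i\<in>I. ennreal (b - a))"
      using A assms by (simp add: LP.emeasure_PiM)
    also have "\<dots> = (\<Prod>i\<in>I. emeasure lborel ({a..b} \<inter> A i) / ennreal (b - a))"
      unfolding divide_ennreal_def inv by (simp add: prod.distrib)
    also have "\<dots> = (\<Prod>i\<in>I. emeasure (uniform_measure lborel {a..b}) (A i))"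
      using A assms by (intro prod.cong) auto
    finally show "emeasure (uniform_measure (Pi\<^sub>M I (\<lambda>_. lborel)) (I \<rightarrow>\<^sub>E {a..b})) (Pi\<^sub>E I A)
      = (\<Prod>i\<in>I. emeasure (uniform_measure lborel {a..b}) (A i))" .
  qed (use assms in auto)
qed

text \<open>\<open>lborel\<close> on a Euclidean space is the image of a product of one-dimensional
  Lebesgue measures under the map that assembles coordinates, and the cube pulls back to a product
  of intervals. This carries the tensorized inequality over to vectors.\<close>

lemma uniform_measure_cube:
  fixes r :: real
  assumes "0 < r"
  shows "uniform_measure lborel (cbox (- r *\<^sub>R One) (r *\<^sub>R One) :: 'a::euclidean_space set)
    = distr (PiM Basis (\<lambda>_. uniform_measure lborel {-r..r})) borel (\<lambda>x. \<Sum>b\<in>Basis. x b *\<^sub>R b)"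
    (is "uniform_measure lborel ?Q = distr ?P borel ?S")
proof -
  let ?N = "PiM (Basis :: 'a set) (\<lambda>_. lborel :: real measure)"
  let ?B = "(Basis :: 'a set) \<rightarrow>\<^sub>E {-r..r}"
  have P: "?P = uniform_measure ?N ?B"
    using assms by (intro PiM_uniform_measure_Icc) auto
  have S: "?S \<in> measurable ?N borel" by measurable
  have B: "?B \<in> sets ?N" by (intro sets_PiM_I_finite) auto
  have S_Q: "?S -` ?Q \<inter> space ?N = ?B"
    by (auto simp: space_PiM PiE_def Pi_def mem_box inner_sum_left_Basis)
  have lb: "emeasure lborel A = emeasure ?N (?S -` A \<inter> space ?N)" if "A \<in> sets borel" for A :: "'a set"
    by (subst lborel_eq, subst emeasure_distr) (use that S in auto)
  show ?thesis
  proof (rule measure_eqI)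
    fix A :: "'a set" assume "A \<in> sets (uniform_measure lborel ?Q)"
    then have A: "A \<in> sets borel" by simp
    have "emeasure (uniform_measure lborel ?Q) A = emeasure lborel (?Q \<inter> A) / emeasure lborel ?Q"
      using A by (subst emeasure_uniform_measure) auto
    also have "\<dots> = emeasure ?N (?S -` (?Q \<inter> A) \<inter> space ?N) / emeasure ?N ?B"
      using A S_Q by (subst (1 2) lb) auto
    also have "?S -` (?Q \<inter> A) \<inter> space ?N = ?B \<inter> (?S -` A \<inter> space ?N)"
      using S_Q by auto
    also have "emeasure ?N \<dots> / emeasure ?N ?B = emeasure ?P (?S -` A \<inter> space ?N)"
      unfolding P using B S A by (subst emeasure_uniform_measure) (auto intro: measurable_sets)
    also have "\<dots> = emeasure (distr ?P borel ?S) A"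
      using A S unfolding P by (subst emeasure_distr) (auto simp: measurable_cong_sets[OF sets_uniform_measure refl])
    finally show "emeasure (uniform_measure lborel ?Q) A = emeasure (distr ?P borel ?S) A" .
  qed simp
qed

text \<open>Tensorization along the coordinate axes: on each line the one-dimensional inequality
  applies, and the squared partial derivatives add up to the squared norm of the gradient.\<close>

lemma log_sobolev_cube:
  fixes H :: "'a::euclidean_space \<Rightarrow> real" and G :: "'a \<Rightarrow> 'a"
  assumes r: "0 < r" and H: "\<And>x. GDERIV H x :> G x" and contG: "continuous_on UNIV G"
    and pos: "\<And>x. 0 < H x"
  defines "U \<equiv> uniform_measure lborel (cbox (- r *\<^sub>R One) (r *\<^sub>R One) :: 'a set)"
  shows "(\<integral>x. H x * ln (H x) \<partial>U) - (\<integral>x. H x \<partial>U) * ln (\<integral>x. H x \<partial>U)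
    \<le> (2 * r)\<^sup>2 * (\<integral>x. (norm (G x))\<^sup>2 / H x \<partial>U)"
proof -
  define Q :: "'a set" where "Q = cbox (- r *\<^sub>R One) (r *\<^sub>R One)"
  \<comment> \<open>Tensorization wants bounds on the whole product space, whereas \<open>H\<close>
    is bounded above and away from zero only on the cube. Composing with the projection onto the
    cube gives global bounds and changes nothing almost everywhere for the uniform measure.\<close>
  define cl :: "'a \<Rightarrow> 'a" where "cl = clamp (- r *\<^sub>R One) (r *\<^sub>R One)"
  define S :: "('a \<Rightarrow> real) \<Rightarrow> 'a" where "S x = (\<Sum>b\<in>Basis. x b *\<^sub>R b)" for x
  define M where "M = uniform_measure lborel {-r..r}"
  define P where "P = PiM (Basis :: 'a set) (\<lambda>_. M)"
  interpret M: prob_space M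
    unfolding M_def using r by (intro prob_space_uniform_measure) auto
  have contH: "continuous_on UNIV H"
    using H by (intro continuous_at_imp_continuous_on) (auto simp: gderiv_def intro: has_derivative_continuous)
  have cl_coord: "cl y \<bullet> b = (if y \<bullet> b < - r then - r else if y \<bullet> b \<le> r then y \<bullet> b else r)" if "b \<in> Basis" for y b
    using that r unfolding cl_def clamp_def by (simp add: inner_sum_left_Basis)
  have cl_Q: "cl y \<in> Q" for y
    using r unfolding Q_def by (auto simp: mem_box cl_coord)
  have cl_id: "cl y = y" if "y \<in> Q" for y
    using that unfolding Q_def cl_def by simp
  have contcl: "continuous_on UNIV (\<lambda>y. h (cl y))" if "continuous_on UNIV h" for h :: "'a \<Rightarrow> real"
    unfolding cl_def by (intro clamp_continuous_on continuous_on_subset[OF that]) auto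
  have bnd: "\<exists>B. \<forall>y. \<bar>h (cl y)\<bar> \<le> B" if "continuous_on UNIV h" for h :: "'a \<Rightarrow> real"
  proof -
    have "bounded (h ` Q)"
      unfolding Q_def
      by (rule compact_imp_bounded[OF compact_continuous_image[OF continuous_on_subset[OF that]]]) auto
    then obtain B where "\<And>x. x \<in> Q \<Longrightarrow> norm (h x) \<le> B"
      unfolding bounded_iff by auto
    then show ?thesis using cl_Q by (intro exI[of _ B]) auto
  qed
  obtain C where C: "\<And>y. H (cl y) \<le> C" using bnd[OF contH] by (metis abs_le_iff)
  obtain c where c: "0 < c" "\<And>y. c \<le> H (cl y)"
  proof -
    have "0 \<in> Q" using r by (auto simp: Q_def mem_box)
    then obtain z where "z \<in> Q" "\<And>y. y \<in> Q \<Longrightarrow> H z \<le> H y"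
      using continuous_attains_inf[of Q H] continuous_on_subset[OF contH] unfolding Q_def by (metis compact_cbox empty_iff subset_UNIV)
    then show ?thesis using that[of "H z"] pos cl_Q by auto
  qed
  define E where "E b y = (G y \<bullet> b)\<^sup>2 / H y" for b y
  have contE: "continuous_on UNIV (E b)" for b
    unfolding E_def using pos by (intro continuous_intros contG contH) (auto simp: less_imp_neq[symmetric])
  have "\<exists>K. \<forall>y. \<bar>(2 * r)\<^sup>2 * E b (cl y)\<bar> \<le> K" for b
    by (rule bnd) (intro continuous_intros contE)
  then obtain K where K: "\<And>b y. \<bar>(2 * r)\<^sup>2 * E b (cl y)\<bar> \<le> K b" by metis
  define B where "B = Max (K ` Basis)"
  have B: "\<bar>(2 * r)\<^sup>2 * E b (cl y)\<bar> \<le> B" if "b \<in> Basis" for b y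
    unfolding B_def by (rule order_trans[OF K[of b y] Max_ge]) (use that in auto)
  have S_meas: "S \<in> measurable P borel"
  proof -
    have "S \<in> measurable (PiM (Basis :: 'a set) (\<lambda>_. lborel)) borel" unfolding S_def by measurable
    moreover have "sets P = sets (PiM (Basis :: 'a set) (\<lambda>_. lborel :: real measure))"
      unfolding P_def M_def by (rule sets_PiM_cong) auto
    ultimately show ?thesis by (simp cong: measurable_cong_sets)
  qed
  have meas: "(\<lambda>x. h (cl (S x))) \<in> borel_measurable P" if "continuous_on UNIV h" for h :: "'a \<Rightarrow> real"
    using measurable_compose[OF S_meas borel_measurable_continuous_onI[OF contcl[OF that]]] .
  have tens: "(\<integral>x. H (cl (S x)) * ln (H (cl (S x))) \<partial>P) - (\<integral>x. H (cl (S x)) \<partial>P) * ln (\<integral>x. H (cl (S x)) \<partial>P)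
    \<le> (\<Sum>b\<in>Basis. \<integral>x. (2 * r)\<^sup>2 * E b (cl (S x)) \<partial>P)"
    unfolding P_def
  proof (rule M.entropy_tensorization[where c = c and C = C and B = B])
    show "(\<lambda>x. (2 * r)\<^sup>2 * E b (cl (S x))) \<in> borel_measurable (Pi\<^sub>M Basis (\<lambda>_. M))" for b
      using meas[OF contE] unfolding P_def by simp
    fix b :: 'a and x :: "'a \<Rightarrow> real" assume b: "b \<in> Basis"
    \<comment> \<open>Clamping acts coordinatewise. As 0 lies in the interval, coordinate
      \<open>b\<close> of \<open>z\<close> is 0, and for \<open>t\<close> in the interval the
      clamped line is \<open>z + t *\<^sub>R b\<close>.\<close>
    define z where "z = cl (S (x(b := 0)))"
    have S_upd: "S (x(b := t)) \<bullet> b' = (if b' = b then t else x b')" if "b' \<in> Basis" for b' t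
      using that by (simp add: S_def inner_sum_left_Basis)
    have cl_upd: "cl (S (x(b := t))) = z + t *\<^sub>R b" if "- r \<le> t" "t \<le> r" for t
    proof (rule euclidean_eqI)
      fix b' :: 'a assume b': "b' \<in> Basis"
      show "cl (S (x(b := t))) \<bullet> b' = (z + t *\<^sub>R b) \<bullet> b'"
        using b b' that r by (simp add: z_def cl_coord S_upd inner_add_left inner_Basis)
    qed
    have S_line: "S (x(b := t)) = S (x(b := 0)) + t *\<^sub>R b" for t
      by (rule euclidean_eqI) (use b in \<open>auto simp: S_upd inner_add_left inner_Basis\<close>)
    have line: "(\<lambda>t. h (cl (S (x(b := t))))) \<in> borel_measurable borel" if "continuous_on UNIV h" for h :: "'a \<Rightarrow> real"
    proof -
      have "(\<lambda>t. h (cl (S (x(b := 0)) + t *\<^sub>R b))) \<in> borel_measurable borel"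
        by (rule borel_measurable_continuous_onI, rule continuous_on_compose2[OF contcl[OF that]])
           (auto intro!: continuous_intros)
      then show ?thesis by (subst S_line)
    qed
    have "(\<integral>t. H (cl (S (x(b := t)))) * ln (H (cl (S (x(b := t))))) \<partial>M)
        - (\<integral>t. H (cl (S (x(b := t)))) \<partial>M) * ln (\<integral>t. H (cl (S (x(b := t)))) \<partial>M)
        \<le> (r - - r)\<^sup>2 * (\<integral>t. E b (cl (S (x(b := t)))) \<partial>M)"
      unfolding M_def
    proof (rule log_sobolev_interval[where f = "\<lambda>t. H (z + t *\<^sub>R b)" and f' = "\<lambda>t. G (z + t *\<^sub>R b) \<bullet> b"])
      fix t :: real
      have "((\<lambda>t. H (z + t *\<^sub>R b)) has_derivative (\<lambda>h. G (z + t *\<^sub>R b) \<bullet> (h *\<^sub>R b))) (at t)"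
        by (rule has_derivative_compose[OF _ H[unfolded gderiv_def], THEN has_derivative_eq_rhs])
           (auto intro!: derivative_eq_intros simp: inner_commute)
      then show "((\<lambda>t. H (z + t *\<^sub>R b)) has_real_derivative G (z + t *\<^sub>R b) \<bullet> b) (at t)"
        unfolding has_field_derivative_def by (rule has_derivative_eq_rhs) (auto simp: mult.commute)
      show "continuous_on {- r..r} (\<lambda>t. G (z + t *\<^sub>R b) \<bullet> b)"
        by (intro continuous_intros continuous_on_compose2[OF contG]) auto
    qed (use r pos line[OF contH] line[OF contE] cl_upd in \<open>auto simp: E_def\<close>)
    then show "(\<integral>t. H (cl (S (x(b := t)))) * ln (H (cl (S (x(b := t))))) \<partial>M)
        - (\<integral>t. H (cl (S (x(b := t)))) \<partial>M) * ln (\<integral>t. H (cl (S (x(b := t)))) \<partial>M)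
        \<le> (\<integral>t. (2 * r)\<^sup>2 * E b (cl (S (x(b := t)))) \<partial>M)"
      by simp
  qed (use c C B meas[OF contH] in \<open>auto simp: P_def\<close>)
  have U: "U = distr P borel S"
    unfolding U_def P_def M_def S_def [abs_def] by (rule uniform_measure_cube[OF r])
  have AEU: "AE x in U. x \<in> Q"
    unfolding U_def Q_def by (rule AE_uniform_measureI) auto
  have setsU: "sets U = sets borel" by (simp add: U_def)
  have conv: "(\<integral>x. h (cl (S x)) \<partial>P) = (\<integral>x. h x \<partial>U)" if "continuous_on UNIV h" for h :: "'a \<Rightarrow> real"
  proof -
    have "(\<integral>x. h (cl (S x)) \<partial>P) = (\<integral>x. h (cl x) \<partial>U)"
      unfolding U by (rule integral_distr[symmetric, OF S_meas])
        (intro borel_measurable_continuous_onI contcl that)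
    also have "\<dots> = (\<integral>x. h x \<partial>U)"
      by (rule integral_cong_AE)
         (use AEU cl_id that contcl in \<open>auto simp: measurable_cong_sets[OF setsU refl] intro!: borel_measurable_continuous_onI elim!: eventually_mono\<close>)
    finally show ?thesis .
  qed
  have contHln: "continuous_on UNIV (\<lambda>x. H x * ln (H x))"
    using pos by (intro continuous_intros contH) (auto simp: less_imp_neq[symmetric])
  have "(\<Sum>b\<in>Basis. \<integral>x. (2 * r)\<^sup>2 * E b (cl (S x)) \<partial>P) = (2 * r)\<^sup>2 * (\<Sum>b\<in>Basis. \<integral>x. E b (cl (S x)) \<partial>P)"
    by (simp add: sum_distrib_left)
  also have "(\<Sum>b\<in>Basis. \<integral>x. E b (cl (S x)) \<partial>P) = (\<integral>x. (\<Sum>b\<in>Basis. E b (cl (S x))) \<partial>P)"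
  proof (rule Bochner_Integration.integral_sum[symmetric])
    interpret PP: product_prob_space "\<lambda>_. M" "Basis :: 'a set" by standard
    interpret P: prob_space P unfolding P_def by (rule PP.prob_space_axioms)
    fix b :: 'a
    obtain K where "\<And>y. \<bar>E b (cl y)\<bar> \<le> K" using bnd[OF contE] by auto
    then show "integrable P (\<lambda>x. E b (cl (S x)))"
      using meas[OF contE] by (intro P.integrable_const_bound[where B = K]) auto
  qed
  also have "(\<lambda>x. \<Sum>b\<in>Basis. E b (cl (S x))) = (\<lambda>x. (norm (G (cl (S x))))\<^sup>2 / H (cl (S x)))"
  proof
    fix x
    have "(norm v)\<^sup>2 = (\<Sum>b\<in>Basis. (v \<bullet> b)\<^sup>2)" for v :: 'a
      unfolding power2_norm_eq_inner by (subst euclidean_inner) (simp add: power2_eq_square)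
    then show "(\<Sum>b\<in>Basis. E b (cl (S x))) = (norm (G (cl (S x))))\<^sup>2 / H (cl (S x))"
      by (simp add: E_def sum_divide_distrib)
  qed
  also have "(\<integral>x. (norm (G (cl (S x))))\<^sup>2 / H (cl (S x)) \<partial>P) = (\<integral>x. (norm (G x))\<^sup>2 / H x \<partial>U)"
    by (rule conv) (use pos in \<open>auto intro!: continuous_intros contH contG simp: less_imp_neq[symmetric]\<close>)
  finally show ?thesis
    using tens by (simp only: conv[OF contH] conv[OF contHln])
qed


section \<open>Local estimates for a locally bounded potential\<close>

lemma density_exp_set_integral_bounds:
  fixes F u :: "'a::euclidean_space \<Rightarrow> real"
  assumes F: "F \<in> borel_measurable borel" "\<And>x. x \<in> Q \<Longrightarrow> \<bar>F x\<bar> \<le> B"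
    and Q: "compact Q" and u: "continuous_on UNIV u" "\<And>x. 0 \<le> u x"
  defines "\<mu> \<equiv> density lborel (\<lambda>x. ennreal (exp (- 2 * F x)))"
  shows "(LINT x:Q|\<mu>. u x) \<le> exp (2 * B) * (LINT x:Q|lborel. u x)"
    and "(LINT x:Q|lborel. u x) \<le> exp (2 * B) * (LINT x:Q|\<mu>. u x)"
proof -
  have [measurable]: "u \<in> borel_measurable borel" "Q \<in> sets borel" "F \<in> borel_measurable borel"
    using u Q F by (auto intro: borel_measurable_continuous_onI borel_compact)
  have int: "integrable lborel (\<lambda>x. indicator Q x * u x)"
    using borel_integrable_compact[OF Q continuous_on_subset[OF u(1)]]
    by simp
  have w: "exp (- 2 * F x) \<le> exp (2 * B)" "exp (- 2 * B) \<le> exp (- 2 * F x)" if "x \<in> Q" for x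
    using F(2)[OF that] by auto
  have eq: "(LINT x:Q|\<mu>. u x) = (\<integral>x. exp (- 2 * F x) * (indicator Q x * u x) \<partial>lborel)"
    unfolding set_lebesgue_integral_def \<mu>_def by (subst integral_density) auto
  have int': "integrable lborel (\<lambda>x. exp (- 2 * F x) * (indicator Q x * u x))"
    by (rule Bochner_Integration.integrable_bound[of _ "\<lambda>x. exp (2 * B) * (indicator Q x * u x)"])
       (use int w u in \<open>auto simp: abs_mult indicator_def intro!: mult_right_mono\<close>)
  show "(LINT x:Q|\<mu>. u x) \<le> exp (2 * B) * (LINT x:Q|lborel. u x)"
    unfolding eq unfolding set_lebesgue_integral_def
    by (subst integral_mult_right_zero[symmetric], rule integral_mono)
       (use int int' w u in \<open>auto simp: indicator_def intro!: mult_right_mono\<close>)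
  have "exp (- 2 * B) * (LINT x:Q|lborel. u x) \<le> (LINT x:Q|\<mu>. u x)"
    unfolding eq unfolding set_lebesgue_integral_def
    by (subst integral_mult_right_zero[symmetric], rule integral_mono)
       (use int int' w u in \<open>auto simp: indicator_def intro!: mult_right_mono\<close>)
  then have "exp (2 * B) * (exp (- 2 * B) * (LINT x:Q|lborel. u x)) \<le> exp (2 * B) * (LINT x:Q|\<mu>. u x)"
    by (intro mult_left_mono) auto
  then show "(LINT x:Q|lborel. u x) \<le> exp (2 * B) * (LINT x:Q|\<mu>. u x)"
    unfolding mult.assoc[symmetric] exp_add[symmetric] by simp
qed

text \<open>The Pythagorean identity of Bregman divergences: \<open>ent_gap c\<close> and
  \<open>ent_gap m\<close> differ by an affine function, whose integral depends on \<open>H\<close>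
  only through its mean. The measure is not normalized because it will be the restriction of
  \<open>\<mu>\<close> to a cube.\<close>

lemma ent_gap_mean:
  fixes H :: "'a \<Rightarrow> real"
  assumes "finite_measure N" "integrable N H" "integrable N (\<lambda>x. H x * ln (H x))"
    and pos: "\<And>x. 0 < H x" and c: "0 < c" and mean: "m * measure N (space N) = (\<integral>x. H x \<partial>N)" "0 < m"
  shows "(\<integral>x. ent_gap c (H x) \<partial>N) = (\<integral>x. ent_gap m (H x) \<partial>N) + measure N (space N) * ent_gap c m"
proof -
  interpret finite_measure N by fact
  have *: "ent_gap k (H x) = H x * ln (H x) - H x * ln k - H x + k" if "0 < k" for x k
    using that pos by (simp add: ent_gap_eq)
  have "(\<integral>x. ent_gap k (H x) \<partial>N) =
    (\<integral>x. H x * ln (H x) \<partial>N) - (m * measure N (space N)) * ln k - m * measure N (space N) + measure N (space N) * k"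
    if "0 < k" for k
    using assms that by (simp add: *)
  from this[OF c] this[OF mean(2)]
  show "(\<integral>x. ent_gap c (H x) \<partial>N) = (\<integral>x. ent_gap m (H x) \<partial>N) + measure N (space N) * ent_gap c m"
    using c mean(2) by (simp add: ent_gap_eq algebra_simps)
qed

text \<open>The density of \<open>\<mu>\<close> is bounded above and below on the cube, and the entropy around the mean is
  the smallest of all the integrals of \<open>ent_gap c\<close>; so the inequality for the Lebesgue measure
  passes to \<open>\<mu>\<close>.\<close>

lemma log_sobolev_cube_density:
  fixes F :: "'a::euclidean_space \<Rightarrow> real"
  assumes r: "0 < r" and Q: "Q = cbox (- r *\<^sub>R One) (r *\<^sub>R One)"
    and F: "F \<in> borel_measurable borel" "bounded (F ` Q)"
    and \<mu>: "\<mu> = density lborel (\<lambda>x. ennreal (exp (- 2 * F x)))" "prob_space \<mu>"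
    and p: "0 < measure \<mu> Q"
  shows "\<exists>K\<ge>0. \<forall>H G c. (\<forall>x. GDERIV H x :> G x) \<longrightarrow> continuous_on UNIV G \<longrightarrow> (\<forall>x. 0 < H x) \<longrightarrow> 0 < c \<longrightarrow>
     (LINT x:Q|\<mu>. ent_gap c (H x)) \<le> K * (LINT x:Q|\<mu>. (norm (G x))\<^sup>2 / H x)
        + measure \<mu> Q * ent_gap c ((LINT x:Q|\<mu>. H x) / measure \<mu> Q)"
proof -
  interpret prob_space \<mu> by fact
  obtain B where B: "\<And>x. x \<in> Q \<Longrightarrow> \<bar>F x\<bar> \<le> B"
    using F(2) unfolding bounded_iff by auto
  have Q_sets: "Q \<in> sets borel" "compact Q" unfolding Q by auto
  have sets\<mu>: "sets \<mu> = sets borel" "space \<mu> = UNIV" unfolding \<mu> by auto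
  define U where "U = uniform_measure lborel Q"
  define v where "v = measure lborel Q"
  have v: "0 < v"
    using r unfolding v_def Q by (simp add: content_cbox_if inner_sum_left_Basis box_eq_empty prod_pos)
  interpret U: prob_space U
    unfolding U_def using v emeasure_lborel_cbox_finite[of "- r *\<^sub>R One" "r *\<^sub>R One :: 'a"] by (intro prob_space_uniform_measure) (auto simp: v_def measure_def Q)
  define N where "N = restrict_space \<mu> Q"
  have N: "finite_measure N" "measure N (space N) = measure \<mu> Q"
    unfolding N_def using Q_sets sets\<mu>
    by (auto intro!: finite_measure_restrict_space simp: space_restrict_space measure_restrict_space)
  have intN: "(\<integral>x. h x \<partial>N) = (LINT x:Q|\<mu>. h x)" for h :: "'a \<Rightarrow> real"
    unfolding N_def set_lebesgue_integral_def using Q_sets sets\<mu> by (subst integral_restrict_space) auto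
  have intU: "(\<integral>x. h x \<partial>U) = (LINT x:Q|lborel. h x) / v" if "continuous_on UNIV h" for h :: "'a \<Rightarrow> real"
    unfolding U_def v_def using Q_sets v that
    by (intro set_lebesgue_integral_uniform_measure) (auto simp: v_def intro: borel_measurable_continuous_onI)
  have bndQ: "\<exists>K. \<forall>x\<in>Q. \<bar>h x\<bar> \<le> K" if "continuous_on UNIV h" for h :: "'a \<Rightarrow> real"
    using compact_imp_bounded[OF compact_continuous_image[OF continuous_on_subset[OF that] Q_sets(2)]]
    unfolding bounded_iff by auto
  have integN: "integrable N h" if "continuous_on UNIV h" for h :: "'a \<Rightarrow> real"
  proof -
    interpret N: finite_measure N by (rule N)
    obtain K where "\<And>x. x \<in> Q \<Longrightarrow> \<bar>h x\<bar> \<le> K" using bndQ[OF \<open>continuous_on UNIV h\<close>] by auto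
    moreover have "h \<in> borel_measurable N"
      unfolding N_def using borel_measurable_continuous_onI[OF that] sets\<mu>
      by (intro measurable_restrict_space1) (simp add: measurable_cong_sets[OF sets\<mu>(1) refl])
    ultimately show ?thesis
      by (intro N.integrable_const_bound[of _ K]) (auto simp: N_def space_restrict_space intro!: AE_I2)
  qed
  have integU: "integrable U h" if "continuous_on UNIV h" for h :: "'a \<Rightarrow> real"
  proof -
    obtain K where "\<And>x. x \<in> Q \<Longrightarrow> \<bar>h x\<bar> \<le> K" using bndQ[OF \<open>continuous_on UNIV h\<close>] by auto
    moreover have "sets U = sets borel" by (simp add: U_def)
    then have "h \<in> borel_measurable U"
      using borel_measurable_continuous_onI[OF that] by (simp cong: measurable_cong_sets)
    moreover have "AE x in U. x \<in> Q"
      unfolding U_def by (rule AE_uniform_measureI) (use Q_sets in auto)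
    ultimately show ?thesis
      by (intro U.integrable_const_bound[of _ K]) (auto elim!: eventually_mono)
  qed
  show ?thesis
  \<comment> \<open>The Holley-Stroock perturbation argument: each of the two changes of measure, in
    the entropy and in the gradient term, costs \<open>exp (2 * B)\<close>. The other factor is the
    squared side of the cube.\<close>
  proof (intro exI[of _ "exp (4 * B) * (2 * r)\<^sup>2"] conjI allI impI)
    fix H :: "'a \<Rightarrow> real" and G and c :: real
    assume H: "\<forall>x. GDERIV H x :> G x" and G: "continuous_on UNIV G" and pos: "\<forall>x. 0 < H x" and c: "0 < c"
    have contH: "continuous_on UNIV H"
      using H by (intro continuous_at_imp_continuous_on) (auto simp: gderiv_def intro: has_derivative_continuous)
    have contHln: "continuous_on UNIV (\<lambda>x. H x * ln (H x))"
      using pos by (intro continuous_intros contH) (auto simp: less_imp_neq[symmetric])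
    have contE: "continuous_on UNIV (\<lambda>x. (norm (G x))\<^sup>2 / H x)"
      using pos by (intro continuous_intros contH G) (auto simp: less_imp_neq[symmetric])
    have contgap: "continuous_on UNIV (\<lambda>x. ent_gap k (H x))" if "0 < k" for k
      using pos that unfolding ent_gap_def by (intro continuous_intros contH) (auto simp: less_imp_neq[symmetric])
    obtain z where z: "z \<in> Q" "\<And>y. y \<in> Q \<Longrightarrow> H z \<le> H y"
    proof -
      have "0 \<in> Q" using r by (auto simp: Q mem_box)
      then show ?thesis
        using continuous_attains_inf[of Q H] continuous_on_subset[OF contH] Q_sets(2) that by (metis empty_iff subset_UNIV)
    qed
    define m where "m = (LINT x:Q|\<mu>. H x) / measure \<mu> Q"
    \<comment> \<open>\<open>m\<close> is the mean for \<open>\<mu>\<close>, \<open>k\<close> the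
      mean for Lebesgue measure on the cube. Moving the base point from \<open>m\<close> to
      \<open>k\<close> before the change of measure can only increase the integral, and afterwards
      \<open>k\<close> is the base point that yields the Lebesgue entropy.\<close>
    define k where "k = (\<integral>x. H x \<partial>U)"
    have "H z * measure \<mu> Q = (\<integral>x. H z \<partial>N)" using N by simp
    also have "\<dots> \<le> (\<integral>x. H x \<partial>N)"
      by (rule integral_mono[OF finite_measure.integrable_const[OF N(1)] integN[OF contH]])
         (use z in \<open>auto simp: N_def space_restrict_space\<close>)
    finally have "H z \<le> m" using p by (simp add: m_def intN field_simps)
    then have m: "0 < m" using pos by (metis order.strict_trans2)
    have "H z \<le> k" unfolding k_def
    proof (rule U.integral_ge_const[OF integU[OF contH]])
      have "AE x in U. x \<in> Q"
        unfolding U_def by (rule AE_uniform_measureI) (use Q_sets in auto)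
      then show "AE x in U. H z \<le> H x" by eventually_elim (rule z)
    qed
    then have k: "0 < k" using pos by (metis order.strict_trans2)
    have mean: "(LINT x:Q|\<mu>. ent_gap d (H x)) = (LINT x:Q|\<mu>. ent_gap m (H x)) + measure \<mu> Q * ent_gap d m"
      if "0 < d" for d
      using ent_gap_mean[OF N(1) integN[OF contH] integN[OF contHln] pos[rule_format] that _ m] p
      unfolding N(2) intN by (simp add: m_def)
    have "(LINT x:Q|\<mu>. ent_gap m (H x)) \<le> (LINT x:Q|\<mu>. ent_gap k (H x))"
      using mean[OF k] ent_gap_nonneg[OF k m] p by simp
    also have "\<dots> \<le> exp (2 * B) * (LINT x:Q|lborel. ent_gap k (H x))"
      unfolding \<mu> by (rule density_exp_set_integral_bounds)
        (use F B Q_sets contgap[OF k] ent_gap_nonneg[OF k] pos in auto)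
    also have "(LINT x:Q|lborel. ent_gap k (H x)) = v * (\<integral>x. ent_gap k (H x) \<partial>U)"
      using intU[OF contgap[OF k]] v by simp
    also have "(\<integral>x. ent_gap k (H x) \<partial>U) = (\<integral>x. H x * ln (H x) - ln k * H x - H x + k \<partial>U)"
      using k pos by (intro Bochner_Integration.integral_cong) (auto simp: ent_gap_eq)
    also have "\<dots> = (\<integral>x. H x * ln (H x) \<partial>U) - k * ln k"
      using integU[OF contH] integU[OF contHln] by (simp add: U.prob_space k_def)
    also have "\<dots> \<le> (2 * r)\<^sup>2 * (\<integral>x. (norm (G x))\<^sup>2 / H x \<partial>U)"
      unfolding k_def U_def Q by (rule log_sobolev_cube) (use r H G pos in auto)
    also have "(\<integral>x. (norm (G x))\<^sup>2 / H x \<partial>U) = (LINT x:Q|lborel. (norm (G x))\<^sup>2 / H x) / v"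
      by (rule intU[OF contE])
    also have "(LINT x:Q|lborel. (norm (G x))\<^sup>2 / H x) \<le> exp (2 * B) * (LINT x:Q|\<mu>. (norm (G x))\<^sup>2 / H x)"
      unfolding \<mu> by (rule density_exp_set_integral_bounds)
        (use F B Q_sets contE pos in \<open>auto simp: less_imp_le\<close>)
    finally have "(LINT x:Q|\<mu>. ent_gap m (H x))
      \<le> exp (2 * B) * (v * ((2 * r)\<^sup>2 * (exp (2 * B) * (LINT x:Q|\<mu>. (norm (G x))\<^sup>2 / H x) / v)))"
      using v by (simp add: divide_right_mono mult_left_mono)
    also have "\<dots> = (exp (2 * B) * exp (2 * B)) * (2 * r)\<^sup>2 * (LINT x:Q|\<mu>. (norm (G x))\<^sup>2 / H x)"
      using v by simp
    also have "exp (2 * B) * exp (2 * B) = exp (4 * B)"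
      by (simp flip: exp_add)
    finally show "(LINT x:Q|\<mu>. ent_gap c (H x)) \<le> exp (4 * B) * (2 * r)\<^sup>2 * (LINT x:Q|\<mu>. (norm (G x))\<^sup>2 / H x)
        + measure \<mu> Q * ent_gap c ((LINT x:Q|\<mu>. H x) / measure \<mu> Q)"
      using mean[OF c] by (simp add: m_def)
  qed simp
qed

text \<open>Since \<open>Psi\<close> is quadratic near 1 and superlinear at infinity, transporting mass into or out of a
  set of small measure is expensive.\<close>

lemma (in prob_space) mass_transfer_le_Psi:
  fixes h :: "'a \<Rightarrow> real"
  assumes Q: "Q \<in> events" and h: "integrable M h" "\<And>x. 0 \<le> h x" "expectation h = 1"
    and Psi: "integrable M (\<lambda>x. Psi (h x))"
    and S: "0 < S" "6 * exp S * S * (1 - prob Q) \<le> 1"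
  shows "2 * S * (LINT x:Q|M. h x - 1)\<^sup>2 \<le> expectation (\<lambda>x. Psi (h x))"
proof -
  define R where "R = space M - Q"
  have R: "R \<in> events" "prob R = 1 - prob Q" using Q by (auto simp: R_def prob_compl)
  define \<delta> where "\<delta> = (LINT x:Q|M. h x - 1)"
  have intR: "set_integrable M R (\<lambda>x. h x - 1)" "set_integrable M Q (\<lambda>x. h x - 1)" "set_integrable M R h"
    "set_integrable M R (\<lambda>x. Psi (h x))" "set_integrable M R (\<lambda>x. 1 :: real)"
    unfolding set_integrable_def
    by (rule integrable_mult_indicator, use h Psi R Q in simp, use h Psi in simp)+
  have "(LINT x:Q \<union> R|M. h x - 1) = \<delta> + (LINT x:R|M. h x - 1)"
    unfolding \<delta>_def by (rule set_integral_Un) (use intR in \<open>auto simp: R_def\<close>)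
  moreover have "Q \<union> R = space M" using sets.sets_into_space[OF Q] by (auto simp: R_def)
  moreover have "(LINT x:space M|M. h x - 1) = 0"
    using h by (simp add: set_integral_space prob_space)
  ultimately have \<delta>: "(LINT x:R|M. h x - 1) = - \<delta>" by simp
  have one: "(LINT x:R|M. (1::real)) = prob R"
    using R by (simp add: set_lebesgue_integral_def)
  have "(LINT x:R|M. h x - 1) = (LINT x:R|M. h x) - prob R"
    using intR one by (simp add: set_integral_diff)
  moreover have "0 \<le> (LINT x:R|M. h x)" "(LINT x:R|M. h x) \<le> 1"
  proof -
    show "0 \<le> (LINT x:R|M. h x)"
      unfolding set_lebesgue_integral_def using h by (intro integral_nonneg_AE) auto
    have "(LINT x:R|M. h x) \<le> expectation h"
      unfolding set_lebesgue_integral_def using h intR(3)[unfolded set_integrable_def]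
      by (intro integral_mono) (auto simp: indicator_def)
    then show "(LINT x:R|M. h x) \<le> 1" using h by simp
  qed
  moreover have "prob R \<le> 1" "0 \<le> prob R" by auto
  ultimately have "\<bar>\<delta>\<bar> \<le> 1" using \<delta> by linarith
  \<comment> \<open>The sign makes \<open>t * (h x - 1)\<close> integrate to
    \<open>S * \<delta>\<^sup>2\<close> over \<open>R\<close>, where \<open>h x - 1\<close> has
    integral \<open>- \<delta>\<close>. The bound 1 on \<open>\<delta>\<close> keeps
    \<open>t\<close> in the range where the conjugate term is quadratic.\<close>
  define t where "t = - S * \<delta>"
  have s: "\<bar>t\<bar> \<le> S" using S \<open>\<bar>\<delta>\<bar> \<le> 1\<close> by (simp add: t_def abs_mult)
  have "(LINT x:R|M. t * (h x - 1)) \<le> (LINT x:R|M. Psi (h x) / 4 + 3 * (exp S * t\<^sup>2) * 1)"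
  proof (rule set_integral_mono)
    show "set_integrable M R (\<lambda>x. t * (h x - 1))" using intR by (intro set_integrable_mult_right)
    show "set_integrable M R (\<lambda>x. Psi (h x) / 4 + 3 * (exp S * t\<^sup>2) * 1)"
      using intR by (intro set_integral_add set_integrable_mult_right set_integrable_divide)
    fix x
    have "t * ((h x + 2) - 3) \<le> ent_gap 3 (h x + 2) + 3 * (exp t - 1 - t)"
      by (rule ent_gap_dual) (use h(2)[of x] in auto)
    also have "\<dots> \<le> Psi (h x) / 4 + 3 * (exp S * t\<^sup>2)"
    proof (rule add_mono)
      show "ent_gap 3 (h x + 2) \<le> Psi (h x) / 4" using Psi_ent_gap_bounds(1)[OF h(2)[of x]] by simp
      show "3 * (exp t - 1 - t) \<le> 3 * (exp S * t\<^sup>2)" using exp_minus_affine_le[OF s] by simp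
    qed
    finally show "t * (h x - 1) \<le> Psi (h x) / 4 + 3 * (exp S * t\<^sup>2) * 1" by simp
  qed
  also have "\<dots> = (LINT x:R|M. Psi (h x)) / 4 + 3 * (exp S * t\<^sup>2) * prob R"
  proof -
    have "set_integrable M R (\<lambda>x. Psi (h x) / 4)" "set_integrable M R (\<lambda>x. 3 * (exp S * t\<^sup>2) * 1)"
      by (intro set_integrable_divide intR(4), intro set_integrable_mult_right intR(5))
    from set_integral_add(2)[OF this] show ?thesis
      by (simp only: set_integral_divide_zero set_integral_mult_right one)
  qed
  also have "(LINT x:R|M. Psi (h x)) \<le> expectation (\<lambda>x. Psi (h x))"
    unfolding set_lebesgue_integral_def
  proof (rule integral_mono[OF intR(4)[unfolded set_integrable_def] Psi])
    show "indicator R x *\<^sub>R Psi (h x) \<le> Psi (h x)" for x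
      using Psi_nonneg[OF h(2)[of x]] by (simp add: indicator_def)
  qed
  also have "(LINT x:R|M. t * (h x - 1)) = S * \<delta>\<^sup>2"
    unfolding set_integral_mult_right \<delta> by (simp add: t_def power2_eq_square)
  also have "3 * (exp S * t\<^sup>2) * prob R = S * \<delta>\<^sup>2 * (3 * exp S * S * prob R)"
    by (simp add: t_def power2_eq_square)
  finally have "S * \<delta>\<^sup>2 \<le> expectation (\<lambda>x. Psi (h x)) / 4 + S * \<delta>\<^sup>2 * (3 * exp S * S * prob R)"
    by simp
  \<comment> \<open>Here the smallness of the complement enters: the conjugate term consumes at most
    half of the left-hand side.\<close>
  also have "S * \<delta>\<^sup>2 * (3 * exp S * S * prob R) \<le> S * \<delta>\<^sup>2 * (1 / 2)"
    using S R by (intro mult_left_mono) auto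
  finally show ?thesis by (simp add: \<delta>_def)
qed

lemma exists_large_cube:
  fixes \<mu> :: "'a::euclidean_space measure" and K :: "'a set"
  assumes "prob_space \<mu>" "sets \<mu> = sets borel" "compact K" "0 < q"
  shows "\<exists>r>0. K \<subseteq> cbox (- r *\<^sub>R One) (r *\<^sub>R One) \<and> 1 - q \<le> measure \<mu> (cbox (- r *\<^sub>R One) (r *\<^sub>R One))"
proof -
  interpret prob_space \<mu> by fact
  define A :: "nat \<Rightarrow> 'a set" where "A n = cbox (- real n *\<^sub>R One) (real n *\<^sub>R One)" for n
  have sp: "space \<mu> = UNIV" using sets_eq_imp_space_eq[OF assms(2)] by simp
  have in_A: "x \<in> A n" if "norm x \<le> real n" for x n
    using that Basis_le_norm[of _ x] by (fastforce simp: A_def mem_box abs_le_iff)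
  have "(\<Union>n. A n) = UNIV" using in_A[OF of_nat_ceiling] by auto
  moreover have "(\<lambda>n. prob (A n)) \<longlonglongrightarrow> prob (\<Union>n. A n)"
  proof (rule finite_Lim_measure_incseq)
    show "incseq A"
    proof (rule incseq_SucI)
      show "A n \<subseteq> A (Suc n)" for n
        unfolding A_def by (rule subset_box_imp(1)) auto
    qed
  qed (auto simp: assms(2) A_def)
  ultimately have "(\<lambda>n. prob (A n)) \<longlonglongrightarrow> 1" using sp prob_space by simp
  then have "\<forall>\<^sub>F n in sequentially. 1 - q < prob (A n)"
    by (rule order_tendstoD) (use assms in simp)
  moreover obtain B where B: "\<And>x. x \<in> K \<Longrightarrow> norm x \<le> B"
    using compact_imp_bounded[OF assms(3)] unfolding bounded_iff by auto
  have "\<forall>\<^sub>F n in sequentially. K \<subseteq> A n"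
    using eventually_ge_at_top[of "nat \<lceil>B\<rceil>"]
  proof eventually_elim
    case (elim n)
    then have "B \<le> real n" by linarith
    then show ?case using B in_A by (meson order_trans subsetI)
  qed
  ultimately have "\<forall>\<^sub>F n in sequentially. 1 - q < prob (A n) \<and> K \<subseteq> A n \<and> 0 < n"
    using eventually_gt_at_top[of 0] by eventually_elim auto
  then obtain n where "1 - q < prob (A n)" "K \<subseteq> A n" "0 < n"
    using eventually_happens by fastforce
  then show ?thesis by (intro exI[of _ "real n"]) (auto simp: A_def)
qed

text \<open>The point is that \<open>a\<close> may be arbitrarily small: the price is a larger cube
  and a larger \<open>k\<close>, and both are fixed before \<open>h\<close>. The gradient pays for
  the entropy around the mean over the cube, the fraction \<open>a\<close> for the displacement of
  that mean.\<close>

lemma local_Psi_estimate: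
  fixes F :: "'a::euclidean_space \<Rightarrow> real"
  assumes F: "F \<in> borel_measurable borel" "\<And>K. compact K \<Longrightarrow> bounded (F ` K)"
    and \<mu>: "\<mu> = density lborel (\<lambda>x. ennreal (exp (- 2 * F x)))" "prob_space \<mu>"
    and K: "compact K" and a: "0 < a" and b: "0 \<le> b"
  shows "\<exists>Q k. compact Q \<and> K \<subseteq> Q \<and> 0 \<le> k \<and>
     (\<forall>h G. (\<forall>x. GDERIV h x :> G x) \<longrightarrow> continuous_on UNIV G \<longrightarrow> (\<forall>x. 0 \<le> h x) \<longrightarrow> (\<integral>x. h x \<partial>\<mu>) = 1 \<longrightarrow>
        integrable \<mu> (\<lambda>x. Psi (h x)) \<longrightarrow>
        integrable \<mu> (\<lambda>x. deriv (deriv Psi) (h x) * (norm (G x))\<^sup>2) \<longrightarrow>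
        b * (LINT x:Q|\<mu>. Psi (h x)) \<le> k * (\<integral>x. deriv (deriv Psi) (h x) * (norm (G x))\<^sup>2 \<partial>\<mu>)
           + a * (\<integral>x. Psi (h x) \<partial>\<mu>))"
proof -
  interpret prob_space \<mu> by fact
  have sets\<mu>: "sets \<mu> = sets borel" unfolding \<mu> by simp
  \<comment> \<open>The end of the proof needs \<open>16 / 3 * b \<le> a * (2 * S)\<close>; the
    factor 3 is enough for this, and adding 1 keeps \<open>S\<close> positive when
    \<open>b = 0\<close>.\<close>
  define S where "S = 3 * b / a + 1"
  have S: "0 < S" using a b by (simp add: S_def add_nonneg_pos)
  \<comment> \<open>The first bound gives the cube at least half of the mass, so division by
    \<open>p\<close> is harmless; the second is the smallness required by
    \<open>mass_transfer_le_Psi\<close>.\<close>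
  define q where "q = min (1 / 2) (1 / (6 * exp S * S))"
  have q: "0 < q" "q \<le> 1 / 2" "6 * exp S * S * q \<le> 1"
  proof -
    have "6 * exp S * S * q \<le> 6 * exp S * S * (1 / (6 * exp S * S))"
      using S by (intro mult_left_mono) (auto simp: q_def)
    then show "6 * exp S * S * q \<le> 1" using S by simp
  qed (use S in \<open>auto simp: q_def\<close>)
  obtain r where r: "0 < r" "K \<subseteq> cbox (- r *\<^sub>R One) (r *\<^sub>R One)" "1 - q \<le> prob (cbox (- r *\<^sub>R One) (r *\<^sub>R One))"
    using exists_large_cube[OF \<mu>(2) sets\<mu> K q(1)] by auto
  define Q :: "'a set" where "Q = cbox (- r *\<^sub>R One) (r *\<^sub>R One)"
  have Q: "compact Q" "Q \<in> events" unfolding Q_def sets\<mu> by auto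
  define p where "p = prob Q"
  have p: "1 / 2 \<le> p" "1 - p \<le> q" using r q unfolding p_def Q_def by linarith+
  obtain L where L: "0 \<le> L" "\<And>H G c. (\<forall>x. GDERIV H x :> G x) \<Longrightarrow> continuous_on UNIV G \<Longrightarrow> (\<forall>x. 0 < H x) \<Longrightarrow> 0 < c \<Longrightarrow>
     (LINT x:Q|\<mu>. ent_gap c (H x)) \<le> L * (LINT x:Q|\<mu>. (norm (G x))\<^sup>2 / H x)
        + p * ent_gap c ((LINT x:Q|\<mu>. H x) / p)"
    using log_sobolev_cube_density[OF r(1) Q_def F(1) F(2)[OF Q(1)] \<mu>] p unfolding p_def by force
  show ?thesis
  \<comment> \<open>The 8 is the factor in the upper bound of \<open>Psi\<close> by
    \<open>ent_gap 3\<close>, and \<open>L\<close> is the logarithmic Sobolev constant on the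
    cube.\<close>
  proof (intro exI[of _ Q] exI[of _ "8 * b * L"] conjI allI impI)
    fix h :: "'a \<Rightarrow> real" and G
    assume h: "\<forall>x. GDERIV h x :> G x" "continuous_on UNIV G" "\<forall>x. 0 \<le> h x" "(\<integral>x. h x \<partial>\<mu>) = 1"
      and iPsi: "integrable \<mu> (\<lambda>x. Psi (h x))"
      and iJ: "integrable \<mu> (\<lambda>x. deriv (deriv Psi) (h x) * (norm (G x))\<^sup>2)" (is "integrable \<mu> ?J")
    \<comment> \<open>A Bochner integral that is not 0 certifies integrability.\<close>
    have ih: "integrable \<mu> h"
      using h(4) not_integrable_integral_eq by fastforce
    have conth: "continuous_on UNIV h"
      using h by (intro continuous_at_imp_continuous_on) (auto simp: gderiv_def intro: has_derivative_continuous)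
    have setint: "set_integrable \<mu> Q u" if cu: "continuous_on UNIV u" for u :: "'a \<Rightarrow> real"
    proof -
      obtain B where B: "\<And>x. x \<in> Q \<Longrightarrow> \<bar>u x\<bar> \<le> B"
        using compact_imp_bounded[OF compact_continuous_image[OF continuous_on_subset[OF cu] Q(1)]]
        unfolding bounded_iff by auto
      have "u \<in> borel_measurable \<mu>"
        using borel_measurable_continuous_onI[OF cu] by (simp cong: measurable_cong_sets add: sets\<mu>)
      then have "(\<lambda>x. indicator Q x * u x) \<in> borel_measurable \<mu>"
        using Q(2) by simp
      then show ?thesis
        unfolding set_integrable_def using B
        by (intro integrable_const_bound[of _ "max B 0"]) (force simp: indicator_def)+
    qed
    define H where "H x = h x + 2" for x
    have H: "\<forall>x. GDERIV H x :> G x" "\<forall>x. 0 < H x"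
      using h unfolding H_def gderiv_def by (auto intro!: derivative_eq_intros add_nonneg_pos)
    have contH: "continuous_on UNIV H" unfolding H_def by (intro continuous_intros conth)
    have cE: "continuous_on UNIV (\<lambda>x. (norm (G x))\<^sup>2 / H x)"
      using H by (intro continuous_intros contH h) (auto simp: less_imp_neq[symmetric])
    have cgap: "continuous_on UNIV (\<lambda>x. ent_gap 3 (H x))"
      using H unfolding ent_gap_def by (intro continuous_intros contH) (auto simp: less_imp_neq[symmetric])
    define \<delta> where "\<delta> = (LINT x:Q|\<mu>. h x - 1)"
    have \<delta>: "2 * S * \<delta>\<^sup>2 \<le> (\<integral>x. Psi (h x) \<partial>\<mu>)"
      unfolding \<delta>_def
    proof (rule mass_transfer_le_Psi[OF Q(2) ih _ h(4) iPsi S])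
      have "6 * exp S * S * (1 - prob Q) \<le> 6 * exp S * S * q"
        using p S by (intro mult_left_mono) (auto simp: p_def)
      also note q(3)
      finally show "6 * exp S * S * (1 - prob Q) \<le> 1" .
    qed (use h in auto)
    define m where "m = (LINT x:Q|\<mu>. H x) / p"
    have one: "(LINT x:Q|\<mu>. (c::real)) = c * p" for c
      using Q by (simp add: set_lebesgue_integral_def p_def)
    have "(LINT x:Q|\<mu>. H x) = (LINT x:Q|\<mu>. (h x - 1) + 3)" by (simp add: H_def add.commute)
    also have "\<dots> = \<delta> + 3 * p"
    proof -
      have "set_integrable \<mu> Q (\<lambda>x. h x - 1)" "set_integrable \<mu> Q (\<lambda>x. 3 :: real)"
        by (intro setint continuous_intros conth)+
      from set_integral_add(2)[OF this] show ?thesis using one by (simp add: \<delta>_def)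
    qed
    finally have m: "p * (m - 3) = \<delta>" using p by (simp add: m_def field_simps)
    have "0 < p * m"
    proof -
      have "p * 2 = (LINT x:Q|\<mu>. 2)" using one by simp
      also have "\<dots> \<le> (LINT x:Q|\<mu>. H x)"
        by (rule set_integral_mono) (use setint contH h in \<open>auto simp: H_def\<close>)
      finally show ?thesis using p by (simp add: m_def)
    qed
    then have mpos: "0 < m" using p by (simp add: zero_less_mult_iff)
    \<comment> \<open>The mean deviates from 3 by \<open>\<delta> / p\<close>, so the quadratic
      bound gives \<open>\<delta>\<^sup>2 / (3 * p)\<close>, and \<open>p\<close> is at least one
      half.\<close>
    have "p * ent_gap 3 m \<le> p * ((m - 3)\<^sup>2 / 3)"
      using ent_gap_le_square[OF _ mpos, of 3] p by (intro mult_left_mono) auto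
    also have "\<dots> = (p * (m - 3))\<^sup>2 / (3 * p)" using p by (simp add: power2_eq_square field_simps)
    also have "\<dots> \<le> \<delta>\<^sup>2 / (3 * (1 / 2))"
      unfolding m using p by (intro divide_left_mono) auto
    finally have mean: "p * ent_gap 3 m \<le> 2 / 3 * \<delta>\<^sup>2" by simp
    have "(LINT x:Q|\<mu>. Psi (h x)) \<le> (LINT x:Q|\<mu>. 8 * ent_gap 3 (H x))"
    proof (rule set_integral_mono)
      show "set_integrable \<mu> Q (\<lambda>x. Psi (h x))"
        unfolding set_integrable_def by (rule integrable_mult_indicator[OF Q(2) iPsi])
      show "set_integrable \<mu> Q (\<lambda>x. 8 * ent_gap 3 (H x))" by (intro setint continuous_intros cgap)
    qed (use Psi_ent_gap_bounds h in \<open>auto simp: H_def\<close>)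
    also have "\<dots> = 8 * (LINT x:Q|\<mu>. ent_gap 3 (H x))" by simp
    also have "\<dots> \<le> 8 * (L * (LINT x:Q|\<mu>. (norm (G x))\<^sup>2 / H x) + p * ent_gap 3 m)"
      using L(2)[OF H(1) h(2) H(2), of 3] by (simp add: m_def)
    also have "(LINT x:Q|\<mu>. (norm (G x))\<^sup>2 / H x) \<le> (\<integral>x. ?J x \<partial>\<mu>)"
      unfolding set_lebesgue_integral_def
    proof (rule integral_mono[OF setint[OF cE, unfolded set_integrable_def] iJ])
      fix x
      have hx: "0 \<le> h x" using h by auto
      then have "1 / H x \<le> deriv (deriv Psi) (h x)"
        unfolding deriv_deriv_Psi H_def by (auto simp: field_simps)
      then have "1 / H x * (norm (G x))\<^sup>2 \<le> ?J x" by (intro mult_right_mono) auto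
      moreover have "0 \<le> ?J x" using hx by (auto simp: deriv_deriv_Psi)
      ultimately show "indicator Q x *\<^sub>R ((norm (G x))\<^sup>2 / H x) \<le> ?J x"
        by (auto simp: indicator_def)
    qed
    finally have "(LINT x:Q|\<mu>. Psi (h x)) \<le> 8 * (L * (\<integral>x. ?J x \<partial>\<mu>) + 2 / 3 * \<delta>\<^sup>2)"
      using L(1) mean by (simp add: mult_left_mono)
    then have "b * (LINT x:Q|\<mu>. Psi (h x)) \<le> b * (8 * (L * (\<integral>x. ?J x \<partial>\<mu>) + 2 / 3 * \<delta>\<^sup>2))"
      by (rule mult_left_mono) (use b in auto)
    also have "\<dots> = 8 * b * L * (\<integral>x. ?J x \<partial>\<mu>) + 16 / 3 * b * \<delta>\<^sup>2" by (simp add: algebra_simps)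
    also have "16 / 3 * b * \<delta>\<^sup>2 \<le> a * (2 * S * \<delta>\<^sup>2)"
    proof -
      have "16 / 3 * b \<le> a * (2 * S)" using a b by (simp add: S_def field_simps)
      then have "16 / 3 * b * \<delta>\<^sup>2 \<le> a * (2 * S) * \<delta>\<^sup>2" by (rule mult_right_mono) simp
      then show ?thesis by (simp add: mult.assoc)
    qed
    also have "\<dots> \<le> a * (\<integral>x. Psi (h x) \<partial>\<mu>)" using \<delta> a by (intro mult_left_mono) auto
    finally show "b * (LINT x:Q|\<mu>. Psi (h x)) \<le> 8 * b * L * (\<integral>x. ?J x \<partial>\<mu>) + a * (\<integral>x. Psi (h x) \<partial>\<mu>)" by simp
  qed (use Q r b L in \<open>auto simp: Q_def\<close>)
qed


section \<open>The Lyapunov function\<close>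

text \<open>Places constants in the extended domain, so that linearity of the generator can be
  applied to \<open>V\<close> plus a constant. The deterministic times \<open>n\<close> localize the
  zero process.\<close>

lemma extended_generator_const: "extended_generator Pr Fil X (\<lambda>_. c) (\<lambda>_. 0)"
proof -
  \<comment> \<open>For the zero function the two parts of \<open>real_cond_exp\<close> are the same
    expression and cancel, whatever the measure and the filtration.\<close>
  have zero: "martingale M Fil (\<lambda>t \<omega>. 0 :: real)" for M :: "'b measure"
    by (auto simp: martingale_def real_cond_exp_def)
  have "filterlim (\<lambda>n. real n) at_top sequentially" by (rule filterlim_real_sequentially)
  then have "local_martingale M Fil (\<lambda>t \<omega>. 0)" for M :: "'b measure"
    unfolding local_martingale_def using zero
    by (auto intro!: exI[of _ "\<lambda>n _. real n"] stopping_time_const simp: incseq_def)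
  then show ?thesis
    by (auto simp: extended_generator_def set_integrable_def set_lebesgue_integral_def)
qed

lemma extended_generator_add_const:
  "extended_generator Pr Fil X f g \<Longrightarrow> extended_generator Pr Fil X (\<lambda>x. f x + c) g"
  by (auto simp: extended_generator_def)

text \<open>A version for \<open>f\<close> is also one for \<open>f + c\<close>, but
  \<open>L\<close> may select different versions for the two; equality therefore comes from
  linearity and holds only almost everywhere.\<close>

lemma generator_add_const:
  assumes L: "markov_generator Pr Fil X \<mu> L" and f: "f \<in> extended_domain Pr Fil X"
  shows "(\<lambda>x. f x + c) \<in> extended_domain Pr Fil X" "AE x in \<mu>. L (\<lambda>x. f x + c) x = L f x"
proof -
  show "(\<lambda>x. f x + c) \<in> extended_domain Pr Fil X"
    using f extended_generator_add_const unfolding extended_domain_def by fast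
  have "(\<lambda>_. 1) \<in> extended_domain Pr Fil X"
    using extended_generator_const unfolding extended_domain_def by fast
  then have "AE x in \<mu>. L (\<lambda>y. 1 * f y + c * 1) x = 1 * L f x + c * L (\<lambda>_. 1) x"
    by (rule L[unfolded markov_generator_def, THEN conjunct2, THEN conjunct1, rule_format, OF f])
  moreover have "AE x in \<mu>. L (\<lambda>_. 1) x = 0" using L unfolding markov_generator_def by blast
  ultimately show "AE x in \<mu>. L (\<lambda>x. f x + c) x = L f x"
    by eventually_elim simp
qed

text \<open>If only the level sets of \<open>V\<close> are compact, half of the drift absorbs \<open>b\<close> outside a level set.\<close>

lemma lyapunov_compact:
  fixes V LV :: "'a::topological_space \<Rightarrow> real"
  assumes V: "\<And>x. 0 \<le> V x" and a: "0 < a"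
    and LV: "AE x in \<mu>. LV x \<le> - 2 * a * V x + b * indicat_real C x"
    and compactness: "compact C \<or> (\<forall>r. compact {x. V x \<le> r})"
  shows "\<exists>K. compact K \<and> (AE x in \<mu>. LV x \<le> - a * V x + max b 0 * indicat_real K x)"
proof -
  have aV: "0 \<le> a * V x" for x using a V[of x] by simp
  show ?thesis
  proof (cases "compact C")
    case True
    have "- 2 * a * V x + b * indicat_real C x \<le> - a * V x + max b 0 * indicat_real C x" for x
      using aV[of x] by (auto simp: indicator_def max_def)
    then show ?thesis
      using True LV by (intro exI[of _ C]) (auto intro: order_trans elim!: eventually_mono)
  next
    case False
    \<comment> \<open>The threshold is chosen so that outside \<open>K\<close> half of the drift,
      \<open>a * V x\<close>, exceeds \<open>max b 0\<close>.\<close>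
    define K where "K = {x. V x \<le> max b 0 / a}"
    have "- 2 * a * V x + b * indicat_real C x \<le> - a * V x + max b 0 * indicat_real K x" for x
    proof (cases "x \<in> K")
      case True
      then show ?thesis using aV[of x] by (auto simp: indicator_def max_def)
    next
      case False
      then have "\<not> a * V x \<le> max b 0" using a by (simp add: K_def field_simps)
      then show ?thesis using False aV[of x] by (auto simp: indicator_def max_def split: if_splits)
    qed
    moreover have "compact K" using False compactness by (auto simp: K_def)
    ultimately show ?thesis
      using LV by (intro exI[of _ K]) (auto intro: order_trans elim!: eventually_mono)
  qed
qed

section \<open>The weighted inequality on the whole space\<close>

theorem theorem5p6:
  fixes F V :: "real ^ 'd \<Rightarrow> real" and \<mu> :: "(real ^ 'd) measure"
    and Om :: "'w measure" and Pr :: "real ^ 'd \<Rightarrow> 'w measure"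
    and Fil :: "real \<Rightarrow> 'w measure" and X :: "real \<Rightarrow> 'w \<Rightarrow> real ^ 'd"
    and L :: "(real ^ 'd \<Rightarrow> real) \<Rightarrow> (real ^ 'd \<Rightarrow> real)"
    and A :: "(real ^ 'd \<Rightarrow> real) set"
    and CP \<alpha> b :: real and C :: "(real ^ 'd) set"
  assumes F_meas: "F \<in> borel_measurable borel"
    and F_loc_bounded: "\<And>K. compact K \<Longrightarrow> bounded (F ` K)"
    and mu: "\<mu> = density lborel (\<lambda>x. ennreal (exp (- 2 * F x)))"
    and mu_prob: "prob_space \<mu>"
    and process: "markov_process Om Pr Fil X"
    and invariant: "invariant_measure Pr X \<mu>"
    and generator: "markov_generator Pr Fil X \<mu> L"
    and alg: "function_algebra A"
    and smooth: "\<And>f. f \<in> A \<Longrightarrow> C1_function f"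
    and core: "generator_core Pr Fil X \<mu> L A"
    and diffusion: "diffusion_on \<mu> L A"
    and Gamma: "\<And>f. f \<in> A \<Longrightarrow> AE x in \<mu>. carre_du_champ L f f x = (norm (gradient f x))\<^sup>2"
    and poincare: "poincare_inequality \<mu> A CP"
    and V_domain: "V \<in> extended_domain Pr Fil X"
    and V_ge_1: "\<And>x. 1 \<le> V x"
    and alpha_pos: "\<alpha> > 0"
    and lyapunov: "AE x in \<mu>. L V x \<le> - 2 * \<alpha> * V x + b * indicat_real C x"
    and compactness: "compact C \<or> (\<forall>r. compact {x. V x \<le> r})"
  shows "\<exists>l0 :: real. \<forall>l\<ge>l0.
           lyapunov_psi_sobolev Pr Fil X \<mu> L A Psi (\<lambda>x. V x + l)"
proof -
  interpret prob_space \<mu> by fact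
  have sets\<mu>: "sets \<mu> = sets borel" unfolding mu by simp
  obtain K where K: "compact K" "AE x in \<mu>. L V x \<le> - \<alpha> * V x + max b 0 * indicat_real K x"
    using lyapunov_compact[OF _ alpha_pos lyapunov compactness] V_ge_1 by (meson order_trans zero_le_one)
  define \<beta> where "\<beta> = max b 0"
  have \<beta>: "0 \<le> \<beta>" by (simp add: \<beta>_def)
  \<comment> \<open>The fraction \<open>\<alpha> / 2\<close> is half of what the drift provides; the
    other half survives to give the conclusion.\<close>
  obtain Q k where Q: "compact Q" "K \<subseteq> Q" and k: "0 \<le> k" and
    est: "\<And>h G. (\<forall>x. GDERIV h x :> G x) \<Longrightarrow> continuous_on UNIV G \<Longrightarrow> (\<forall>x. 0 \<le> h x) \<Longrightarrow> (\<integral>x. h x \<partial>\<mu>) = 1 \<Longrightarrow>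
        integrable \<mu> (\<lambda>x. Psi (h x)) \<Longrightarrow>
        integrable \<mu> (\<lambda>x. deriv (deriv Psi) (h x) * (norm (G x))\<^sup>2) \<Longrightarrow>
        \<beta> * (LINT x:Q|\<mu>. Psi (h x)) \<le> k * (\<integral>x. deriv (deriv Psi) (h x) * (norm (G x))\<^sup>2 \<partial>\<mu>)
           + \<alpha> / 2 * (\<integral>x. Psi (h x) \<partial>\<mu>)"
    using local_Psi_estimate[OF F_meas F_loc_bounded mu mu_prob K(1) half_gt_zero[OF alpha_pos] \<beta>] by blast
  have V_meas: "V \<in> borel_measurable \<mu>"
    using V_domain unfolding extended_domain_def extended_generator_def
    by (auto cong: measurable_cong_sets simp: sets\<mu>)
  show ?thesis
  \<comment> \<open>With this threshold the weight \<open>(V x + l) / 2\<close> of the gradient term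
    is at least \<open>k\<close>, so it covers the gradient cost of the local estimate.\<close>
  proof (intro exI[of _ "2 * k"] allI impI)
    fix l :: real assume l: "2 * k \<le> l"
    have W_domain: "(\<lambda>x. V x + l) \<in> extended_domain Pr Fil X"
      and LW: "AE x in \<mu>. L (\<lambda>x. V x + l) x = L V x"
      using generator_add_const[OF generator V_domain, of l] by auto
    show "lyapunov_psi_sobolev Pr Fil X \<mu> L A Psi (\<lambda>x. V x + l)"
      unfolding lyapunov_psi_sobolev_def
    \<comment> \<open>Since \<open>V\<close> is at least 1, \<open>V + l\<close> is at most
      \<open>(1 + l) * V\<close>; the remaining factor is the inverse of the surviving drift
      \<open>\<alpha> / 2\<close>.\<close>
    proof (intro conjI allI exI[of _ "2 * (1 + l) / \<alpha>"] ballI impI W_domain)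
      show "1 \<le> V x + l" for x using V_ge_1[of x] l k by linarith
      show "0 < 2 * (1 + l) / \<alpha>" using alpha_pos l k by simp
      fix h assume hA: "h \<in> A" and h: "\<forall>x. 0 \<le> h x" "(\<integral>x. h x \<partial>\<mu>) = 1"
      define R where "R x = 1/2 * (V x + l) * deriv (deriv Psi) (h x) * carre_du_champ L h h x
        - Psi (h x) * L (\<lambda>x. V x + l) x" for x
      assume "integrable \<mu> (\<lambda>x. 1/2 * (V x + l) * deriv (deriv Psi) (h x) * carre_du_champ L h h x
        - Psi (h x) * L (\<lambda>x. V x + l) x)"
      then have R: "integrable \<mu> R" unfolding R_def .
      obtain G where G: "continuous_on UNIV G" "\<forall>x. GDERIV h x :> G x"
        using smooth[OF hA] unfolding C1_function_def by auto
      have grad: "gradient h x = G x" for x using G(2) gradient_eq by metis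
      have h_cont: "continuous_on UNIV h"
        using G by (intro continuous_at_imp_continuous_on) (auto simp: gderiv_def intro: has_derivative_continuous)
      have meas: "u \<in> borel_measurable \<mu>" if "u \<in> borel_measurable borel" for u :: "real ^ 'd \<Rightarrow> real"
        using that by (simp cong: measurable_cong_sets add: sets\<mu>)
      define P where "P x = Psi (h x)" for x
      define J where "J x = deriv (deriv Psi) (h x) * (norm (G x))\<^sup>2" for x
      have P0: "0 \<le> P x" for x unfolding P_def using h by (simp add: Psi_nonneg)
      have J0: "0 \<le> J x" for x unfolding J_def using h by (simp add: deriv_deriv_Psi)
      have "continuous_on UNIV Psi"
        using DERIV_Psi DERIV_isCont continuous_at_imp_continuous_on by blast
      then have P_cont: "continuous_on UNIV P"
        unfolding P_def using h_cont by (rule continuous_on_compose2) auto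
      have P_meas: "P \<in> borel_measurable \<mu>"
        by (rule meas[OF borel_measurable_continuous_onI[OF P_cont]])
      have J_meas: "J \<in> borel_measurable \<mu>"
      proof (rule meas)
        have [measurable]: "h \<in> borel_measurable borel" "(\<lambda>x. (norm (G x))\<^sup>2) \<in> borel_measurable borel"
          using G h_cont by (auto intro!: borel_measurable_continuous_onI continuous_intros)
        show "J \<in> borel_measurable borel"
          unfolding J_def deriv_deriv_Psi by measurable
      qed
      define P_Q where "P_Q x = indicator Q x * P x" for x
      have P_Q: "integrable \<mu> P_Q"
      proof -
        obtain B where B: "\<And>x. x \<in> Q \<Longrightarrow> norm (P x) \<le> B"
          using compact_imp_bounded[OF compact_continuous_image[OF continuous_on_subset[OF P_cont] Q(1)]]
          unfolding bounded_iff by auto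
        have "Q \<in> sets \<mu>" unfolding sets\<mu> using Q by (simp add: borel_compact)
        then have "P_Q \<in> borel_measurable \<mu>" unfolding P_Q_def using P_meas by simp
        moreover have "AE x in \<mu>. norm (P_Q x) \<le> max B 0"
        proof (rule AE_I2)
          show "norm (P_Q x) \<le> max B 0" for x
            using B[of x] by (cases "x \<in> Q") (auto simp: P_Q_def)
        qed
        ultimately show ?thesis by (intro integrable_const_bound)
      qed
      \<comment> \<open>The set \<open>K\<close> may be enlarged to \<open>Q\<close> because
        \<open>\<beta>\<close> is non-negative. Both terms on the left are non-negative, and
        \<open>P_Q\<close> is bounded because \<open>P\<close> is continuous and \<open>Q\<close>
        compact.\<close>
      have lower: "AE x in \<mu>. (V x + l) / 2 * J x + \<alpha> * (P x * V x) \<le> R x + \<beta> * P_Q x"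
        using K(2) LW Gamma[OF hA]
      proof eventually_elim
        case (elim x)
        have "L V x \<le> - \<alpha> * V x + \<beta> * indicat_real Q x"
        proof -
          have "\<beta> * indicat_real K x \<le> \<beta> * indicat_real Q x"
            using Q(2) \<beta> by (auto simp: indicator_def)
          then show ?thesis using elim by (simp add: \<beta>_def)
        qed
        then have "P x * L V x \<le> P x * (- \<alpha> * V x + \<beta> * indicat_real Q x)"
          using P0 by (rule mult_left_mono)
        moreover have "R x = (V x + l) / 2 * J x - P x * L V x"
          using elim by (simp add: R_def P_def J_def grad)
        moreover have "P x * (- \<alpha> * V x + \<beta> * indicat_real Q x) = - (\<alpha> * (P x * V x)) + \<beta> * P_Q x"
          by (simp add: P_Q_def algebra_simps)
        ultimately show ?case by linarith
      qed
      have W1: "1 \<le> V x + l" "2 * k \<le> V x + l" "0 \<le> l" for x using V_ge_1[of x] l k by linarith+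
      have RP: "integrable \<mu> (\<lambda>x. R x + \<beta> * P_Q x)" using R P_Q by simp
      \<comment> \<open>Only the right-hand integrand \<open>R\<close> is assumed integrable. The
        pointwise bound \<open>lower\<close> dominates each of its two non-negative terms
        separately, which gives integrability here and for \<open>J\<close> below.\<close>
      have PV: "integrable \<mu> (\<lambda>x. P x * V x)"
      proof (rule Bochner_Integration.integrable_bound)
        show "integrable \<mu> (\<lambda>x. (R x + \<beta> * P_Q x) / \<alpha>)" using RP by (rule integrable_divide)
        show "(\<lambda>x. P x * V x) \<in> borel_measurable \<mu>" using P_meas V_meas by simp
        show "AE x in \<mu>. norm (P x * V x) \<le> norm ((R x + \<beta> * P_Q x) / \<alpha>)"
          using lower
        proof eventually_elim
          case (elim x)
          have "0 \<le> (V x + l) / 2 * J x" using W1(1)[of x] J0[of x] by simp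
          then have "P x * V x \<le> (R x + \<beta> * P_Q x) / \<alpha>" using elim alpha_pos by (simp add: field_simps)
          moreover have "0 \<le> P x * V x" using P0[of x] V_ge_1[of x] by simp
          ultimately show ?case unfolding real_norm_def by linarith
        qed
      qed
      have J: "integrable \<mu> J"
      proof (rule Bochner_Integration.integrable_bound[OF _ J_meas])
        show "integrable \<mu> (\<lambda>x. 2 * (R x + \<beta> * P_Q x))" using RP by (rule integrable_mult_right)
        show "AE x in \<mu>. norm (J x) \<le> norm (2 * (R x + \<beta> * P_Q x))"
          using lower
        proof eventually_elim
          case (elim x)
          have "1 / 2 * J x \<le> (V x + l) / 2 * J x" using W1(1)[of x] J0[of x] by (intro mult_right_mono) auto
          also have "\<dots> \<le> (V x + l) / 2 * J x + \<alpha> * (P x * V x)"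
            using alpha_pos P0[of x] V_ge_1[of x] by simp
          also note elim
          finally have "J x \<le> 2 * (R x + \<beta> * P_Q x)" by simp
          then show ?case using J0[of x] unfolding real_norm_def by linarith
        qed
      qed
      have P_le: "P x \<le> P x * V x" for x using mult_left_mono[OF V_ge_1 P0, of x x] by simp
      have P: "integrable \<mu> P"
        by (rule Bochner_Integration.integrable_bound[OF PV P_meas])
           (use P_le P0 in \<open>auto intro!: AE_I2 order_trans[OF P_le abs_ge_self]\<close>)
      have W_le: "P x * (V x + l) \<le> (1 + l) * (P x * V x)" for x
        using mult_left_mono[OF P_le[of x] W1(3)] by (simp add: algebra_simps)
      have PW: "integrable \<mu> (\<lambda>x. P x * (V x + l))"
        using PV P by (simp add: distrib_left)
      then show "integrable \<mu> (\<lambda>x. Psi (h x) * (V x + l))" by (simp add: P_def)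
      \<comment> \<open>After integration, the gradient term here cancels against the one in the
        local estimate, and half of the drift absorbs the integral of \<open>P\<close>, because
        \<open>P x \<le> P x * V x\<close>.\<close>
      have "k * (\<integral>x. J x \<partial>\<mu>) + \<alpha> * (\<integral>x. P x * V x \<partial>\<mu>) = (\<integral>x. k * J x + \<alpha> * (P x * V x) \<partial>\<mu>)"
        using J PV by simp
      also have "\<dots> \<le> (\<integral>x. R x + \<beta> * P_Q x \<partial>\<mu>)"
      proof (rule integral_mono_AE)
        show "AE x in \<mu>. k * J x + \<alpha> * (P x * V x) \<le> R x + \<beta> * P_Q x"
          using lower
        proof eventually_elim
          case (elim x)
          have "k * J x \<le> (V x + l) / 2 * J x" using W1(2)[of x] J0[of x] by (intro mult_right_mono) auto
          then have "k * J x + \<alpha> * (P x * V x) \<le> (V x + l) / 2 * J x + \<alpha> * (P x * V x)"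
            by (rule add_right_mono)
          also note elim
          finally show ?case .
        qed
      qed (use J PV RP in auto)
      also have "\<dots> = (\<integral>x. R x \<partial>\<mu>) + \<beta> * (LINT x:Q|\<mu>. Psi (h x))"
      proof -
        have "(LINT x:Q|\<mu>. Psi (h x)) = (\<integral>x. P_Q x \<partial>\<mu>)"
          by (simp add: P_Q_def P_def set_lebesgue_integral_def)
        then show ?thesis using R P_Q by simp
      qed
      also have "\<beta> * (LINT x:Q|\<mu>. Psi (h x)) \<le> k * (\<integral>x. J x \<partial>\<mu>) + \<alpha> / 2 * (\<integral>x. P x \<partial>\<mu>)"
        using est[OF G(2) G(1) h] P J unfolding P_def J_def by simp
      also have "(\<integral>x. P x \<partial>\<mu>) \<le> (\<integral>x. P x * V x \<partial>\<mu>)"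
        by (rule integral_mono[OF P PV]) (rule P_le)
      finally have main: "\<alpha> / 2 * (\<integral>x. P x * V x \<partial>\<mu>) \<le> (\<integral>x. R x \<partial>\<mu>)"
        using alpha_pos by simp
      have "(\<integral>x. P x * (V x + l) \<partial>\<mu>) \<le> (\<integral>x. (1 + l) * (P x * V x) \<partial>\<mu>)"
        by (rule integral_mono[OF PW]) (use PV W_le in auto)
      also have "\<dots> = 2 * (1 + l) / \<alpha> * (\<alpha> / 2 * (\<integral>x. P x * V x \<partial>\<mu>))"
        using alpha_pos by simp
      also have "\<dots> \<le> 2 * (1 + l) / \<alpha> * (\<integral>x. R x \<partial>\<mu>)"
        using main alpha_pos W1(3) by (intro mult_left_mono) auto
      finally show "(\<integral>x. Psi (h x) * (V x + l) \<partial>\<mu>) \<le> 2 * (1 + l) / \<alpha> *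
          (\<integral>x. 1/2 * (V x + l) * deriv (deriv Psi) (h x) * carre_du_champ L h h x
            - Psi (h x) * L (\<lambda>x. V x + l) x \<partial>\<mu>)"
        unfolding P_def R_def .
    qed
  qed
qed

end
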